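(* Let $X=(VX,EX)$ be a graph. Then for every $r\in\mathbb N$, \[ \operatorname{sep}_X(r)-1 \leq \max\{\operatorname{tw}(\Gamma) : \Gamma\leq X,\ |V\Gamma|\leq r\} \leq 15\operatorname{sep}_X(r). \]
   Context: $\Gamma\leq X$ means $\Gamma=(V\Gamma,E\Gamma)$ is a (finite) subgraph of $X$. For a finite graph $\Gamma$, the cutsize $\operatorname{cut}(\Gamma)$ is the minimum cardinality of a subset $S\subseteq V\Gamma$ such that every connected component of $\Gamma-S$ contains at most $\frac12|V\Gamma|$ vertices. The separation profile of a graph $X$ is the function $\operatorname{sep}_X:\mathbb N\to\mathbb N$, $\operatorname{sep}_X(r)=\max\{\operatorname{cut}(\Gamma) : \Gamma\leq X,\ |V\Gamma|\leq r\}$. A tree-decomposition of a graph $\Gamma$ is a pair $(T,\{X_g\}_{g\in VT})$, where $T=(VT,ET)$ is a tree, each $X_g\subseteq V\Gamma$, and: (1) $\bigcup_{g\in VT}X_g=V\Gamma$; (2) for every edge $vw\in E\Gamma$ there is some $g\in VT$ with $v,w\in X_g$; (3) for each $v\in V\Gamma$, the full subgraph of $T$ with vertex set $\{g\in VT : v\in X_g\}$ is connected. Its width is $\max_{g\in VT}|X_g|-1$, and the treewidth $\operatorname{tw}(\Gamma)$ is the minimum width of a tree-decomposition of $\Gamma$. *)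

theory Defs
  imports Graph_Theory.Graph_Theory
begin

text \<open>
  As usual in \<^theory>\<open>Graph_Theory.Graph_Theory\<close>, a simple undirected graph is a symmetric
  loop-free digraph without parallel arcs: \<^locale>\<open>pair_bidirected_digraph\<close> for graphs of
  arbitrary size, \<^locale>\<open>pair_graph\<close> for finite ones. The empty graph is a graph.
\<close>

definition finite_subgraphs :: "'a pair_pre_digraph \<Rightarrow> nat \<Rightarrow> 'a pair_pre_digraph set" where
  "finite_subgraphs X r =
     {\<Gamma>. pair_graph \<Gamma> \<and> subgraph (with_proj \<Gamma>) (with_proj X) \<and> card (pverts \<Gamma>) \<le> r}"

text \<open>
  In a symmetric digraph the strongly connected components are the connected components of
  the underlying undirected graph.
\<close>

definition balanced_cutset :: "'a pair_pre_digraph \<Rightarrow> 'a set \<Rightarrow> bool" where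
  "balanced_cutset \<Gamma> S \<longleftrightarrow> S \<subseteq> pverts \<Gamma> \<and>
     (\<forall>C \<in> pre_digraph.sccs (with_proj \<Gamma> \<restriction> (pverts \<Gamma> - S)).
        real (card (verts C)) \<le> 1 / 2 * real (card (pverts \<Gamma>)))"

definition cutsize :: "'a pair_pre_digraph \<Rightarrow> nat" where
  "cutsize \<Gamma> = (LEAST k. \<exists>S. balanced_cutset \<Gamma> S \<and> card S = k)"

definition separation_profile :: "'a pair_pre_digraph \<Rightarrow> nat \<Rightarrow> nat" where
  "separation_profile X r = Max (cutsize ` finite_subgraphs X r)"

text \<open>
  The constant \<^const>\<open>tree\<close> forbids all directed cycles, hence also the 2-cycle formed by the two
  arcs of an undirected edge; for undirected trees only cycles of length at least 3 count.
  Note that \<^const>\<open>connected\<close> requires a nonempty vertex set.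
\<close>

definition undirected_tree :: "'t pair_pre_digraph \<Rightarrow> bool" where
  "undirected_tree T \<longleftrightarrow> pair_bidirected_digraph T \<and> connected (with_proj T) \<and>
     \<not> (\<exists>p. pre_digraph.cycle (with_proj T) p \<and> 3 \<le> length p)"

definition tree_decomposition ::
    "'a pair_pre_digraph \<Rightarrow> 't pair_pre_digraph \<Rightarrow> ('t \<Rightarrow> 'a set) \<Rightarrow> bool" where
  "tree_decomposition \<Gamma> T B \<longleftrightarrow>
     undirected_tree T \<and>
     (\<forall>g \<in> pverts T. B g \<subseteq> pverts \<Gamma>) \<and>
     (\<Union>g \<in> pverts T. B g) = pverts \<Gamma> \<and>
     (\<forall>(v, w) \<in> parcs \<Gamma>. \<exists>g \<in> pverts T. v \<in> B g \<and> w \<in> B g) \<and>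
     (\<forall>v \<in> pverts \<Gamma>. connected (with_proj T \<restriction> {g \<in> pverts T. v \<in> B g}))"

text \<open>
  The width is an integer, since the empty graph has treewidth \<open>-1\<close>. The maximum exists
  even if the tree is infinite, because all bags lie in the finite vertex set of the graph.
\<close>

definition decomposition_width :: "'t pair_pre_digraph \<Rightarrow> ('t \<Rightarrow> 'a set) \<Rightarrow> int" where
  "decomposition_width T B = Max ((\<lambda>g. int (card (B g))) ` pverts T) - 1"

text \<open>
  Taking the tree nodes to be natural numbers is no restriction: for a finite graph, a tree
  decomposition over any node type can be restricted to a finite subtree, without increasing the
  width.
\<close>

definition treewidth :: "'a pair_pre_digraph \<Rightarrow> int" where
  "treewidth \<Gamma> = (LEAST k. \<exists>(T :: nat pair_pre_digraph) B.
     tree_decomposition \<Gamma> T B \<and> decomposition_width T B = k)"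

end

theory Submission
  imports Defs
begin

text \<open>
  Lower bound: in a tree decomposition the bags meeting a connected set form a subtree. Connected
  sets containing more than half of the vertices meet pairwise, so some bag meets all of them, and
  this bag is a balanced cutset.

  Upper bound: let \<open>s\<close> bound the cutsizes of all induced subgraphs. A graph without brambles of order
  greater than \<open>k\<close> has a tree decomposition into bags of size at most \<open>k\<close>, so it suffices to exclude
  brambles of order greater than \<open>14 s\<close>. Suppose there is one. Halving the union of a subbramble
  with \<open>s\<close> vertices lowers its order by at most \<open>s\<close>; hence the least number \<open>f p\<close> of vertices
  covered by a subbramble of order greater than \<open>p\<close> satisfies \<open>f (p + s) \<ge> 2 f p\<close>. Let \<open>A\<close>
  be the union of a subbramble realising \<open>N = f (8 s)\<close>. As \<open>f (10 s) \<ge> 4 N\<close>, a flow argument routes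
  one unit from each of \<open>4 N\<close> vertices to this subbramble with vertex capacity about \<open>N / s\<close>, where
  the flow can be truncated so that all its vertices are sources or lie in \<open>A\<close>. In the graph \<open>H\<close>
  on these at most \<open>5 N\<close> vertices, deleting \<open>s\<close> vertices stops only about \<open>N\<close> units, so the component
  selected by the subbramble keeps more than half of \<open>H\<close>: a contradiction.
\<close>

section \<open>Connected sets, brambles and rooted decompositions\<close>

text \<open>Connectivity by cuts rather than by walks, because most arguments below look for an edge
  that leaves a set; \<open>conn_iff_rtrancl_on\<close> gives the agreement with reachability. The
  empty set does not count as connected.\<close>

definition conn :: "'a rel \<Rightarrow> 'a set \<Rightarrow> bool" where
  "conn E D \<longleftrightarrow> D \<noteq> {} \<and> (\<forall>A. A \<subseteq> D \<and> A \<noteq> {} \<and> A \<noteq> D \<longrightarrow> (\<exists>u\<in>A. \<exists>v\<in>D - A. (u, v) \<in> E))"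

definition touch :: "'a rel \<Rightarrow> 'a set \<Rightarrow> 'a set \<Rightarrow> bool" where
  "touch E B C \<longleftrightarrow> (\<exists>u\<in>B. \<exists>v\<in>C. u = v \<or> (u, v) \<in> E)"

definition bramble :: "'a rel \<Rightarrow> 'a set set \<Rightarrow> bool" where
  "bramble E \<B> \<longleftrightarrow> (\<forall>B\<in>\<B>. conn E B) \<and> (\<forall>B\<in>\<B>. \<forall>C\<in>\<B>. touch E B C)"

text \<open>The order of a bramble is the least size of a hitting set. Only lower bounds on it
  matter, so no minimum is formed. Finiteness is explicit since \<open>card\<close> is 0 on infinite
  sets.\<close>

definition order_exceeds :: "'a set set \<Rightarrow> nat \<Rightarrow> bool" where
  "order_exceeds \<B> k \<longleftrightarrow> (\<forall>X. finite X \<and> card X \<le> k \<longrightarrow> (\<exists>B\<in>\<B>. B \<inter> X = {}))"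

lemma conn_nonempty: "conn E D \<Longrightarrow> D \<noteq> {}"
  by (simp add: conn_def)

lemma conn_exitE:
  assumes "conn E D" "x \<in> D" "x \<in> A" "y \<in> D" "y \<notin> A"
  obtains u v where "u \<in> D" "u \<in> A" "v \<in> D" "v \<notin> A" "(u, v) \<in> E"
proof -
  have "D \<inter> A \<subseteq> D" "D \<inter> A \<noteq> {}" "D \<inter> A \<noteq> D"
    using assms(2-) by auto
  then have "\<exists>u\<in>D \<inter> A. \<exists>v\<in>D - D \<inter> A. (u, v) \<in> E"
    using assms(1) unfolding conn_def by blast
  then show thesis using that by blast
qed

lemma conn_singleton: "conn E {v}"
  unfolding conn_def by auto

lemma connI_exit:
  assumes "D \<noteq> {}"
    and "\<And>A x y. x \<in> D \<Longrightarrow> x \<in> A \<Longrightarrow> y \<in> D \<Longrightarrow> y \<notin> A \<Longrightarrow> \<exists>u v. u \<in> D \<and> u \<in> A \<and> v \<in> D \<and> v \<notin> A \<and> (u, v) \<in> E"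
  shows "conn E D"
  unfolding conn_def
proof (intro conjI allI impI)
  fix A assume A: "A \<subseteq> D \<and> A \<noteq> {} \<and> A \<noteq> D"
  then obtain x y where "x \<in> A" "y \<in> D" "y \<notin> A" by blast
  then show "\<exists>u\<in>A. \<exists>v\<in>D - A. (u, v) \<in> E"
    using assms(2)[of x A y] A by blast
qed (fact assms(1))

text \<open>Join \<open>x\<close> to \<open>y\<close> through touching vertices \<open>u\<close> of
  \<open>B\<close> and \<open>v\<close> of \<open>C\<close>: the exit from \<open>A\<close> lies
  inside \<open>B\<close> if \<open>u\<close> is outside \<open>A\<close>, inside \<open>C\<close>
  if \<open>v\<close> is still in \<open>A\<close>, and is the edge \<open>(u, v)\<close>
  otherwise.\<close>

lemma conn_Union:
  assumes "\<F> \<noteq> {}" "\<And>D. D \<in> \<F> \<Longrightarrow> conn E D" "\<And>B C. B \<in> \<F> \<Longrightarrow> C \<in> \<F> \<Longrightarrow> touch E B C"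
  shows "conn E (\<Union>\<F>)"
proof (rule connI_exit)
  show "\<Union>\<F> \<noteq> {}" using assms(1,2) conn_nonempty by blast
next
  fix A x y assume *: "x \<in> \<Union>\<F>" "x \<in> A" "y \<in> \<Union>\<F>" "y \<notin> A"
  then obtain B C where BC: "B \<in> \<F>" "C \<in> \<F>" "x \<in> B" "y \<in> C" by blast
  obtain u v where uv: "u \<in> B" "v \<in> C" "u = v \<or> (u, v) \<in> E"
    using assms(3)[OF BC(1,2)] unfolding touch_def by blast
  have inside: "\<exists>u v. u \<in> \<Union>\<F> \<and> u \<in> A \<and> v \<in> \<Union>\<F> \<and> v \<notin> A \<and> (u, v) \<in> E"
    if "D \<in> \<F>" "a \<in> D" "a \<in> A" "b \<in> D" "b \<notin> A" for D a b
    using conn_exitE[OF assms(2)[OF that(1)] that(2-)] that(1) by (metis UnionI)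
  show "\<exists>u v. u \<in> \<Union>\<F> \<and> u \<in> A \<and> v \<in> \<Union>\<F> \<and> v \<notin> A \<and> (u, v) \<in> E"
  proof (cases "u \<in> A")
    case False then show ?thesis using inside[OF BC(1,3) *(2) uv(1)] by blast
  next
    case True
    show ?thesis
    proof (cases "v \<in> A")
      case True then show ?thesis using inside[OF BC(2) uv(2) _ BC(4) *(4)] by blast
    next
      case False then show ?thesis using \<open>u \<in> A\<close> uv BC(1,2) by blast
    qed
  qed
qed

lemma touch_sym: "sym E \<Longrightarrow> touch E B C \<Longrightarrow> touch E C B"
  unfolding touch_def by (metis symD)

lemma touch_self: "B \<noteq> {} \<Longrightarrow> touch E B B"
  unfolding touch_def by blast

lemma conn_insert_adjacent:
  assumes "sym E" "conn E D" "u \<in> D" "(u, v) \<in> E"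
  shows "conn E (insert v D)"
proof -
  have "conn E (\<Union>{D, {v}})"
  proof (rule conn_Union)
    show "touch E B C" if "B \<in> {D, {v}}" "C \<in> {D, {v}}" for B C
      using that assms unfolding touch_def by (auto dest: symD)
  qed (use assms conn_singleton in auto)
  then show ?thesis by simp
qed

text \<open>
  In \<open>tdec E Y \<S>\<close>, \<open>\<S>\<close> is the set of bags of a tree decomposition of the graph induced by
  \<open>\<Union>\<S>\<close>, and \<open>Y\<close> is the bag of the root; the tree itself is not recorded.
\<close>

inductive tdec :: "'a rel \<Rightarrow> 'a set \<Rightarrow> 'a set set \<Rightarrow> bool" for E where
  leaf: "tdec E Y {Y}"
| join: "tdec E Y \<S> \<Longrightarrow> tdec E Z \<T> \<Longrightarrow> \<Union>\<S> \<inter> \<Union>\<T> \<subseteq> Y \<inter> Z \<Longrightarrow>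
    E \<inter> (\<Union>\<S> - \<Union>\<T>) \<times> (\<Union>\<T> - \<Union>\<S>) = {} \<Longrightarrow> tdec E Y (\<S> \<union> \<T>)"

lemma tdec_root: "tdec E Y \<S> \<Longrightarrow> Y \<in> \<S>"
  by (induction rule: tdec.induct) auto

text \<open>\<open>join\<close> forbids edges between the private parts of its two halves, so by
  symmetry each edge lies within one half.\<close>

lemma tdec_edge:
  assumes "tdec E Y \<S>" "sym E"
  shows "(u, v) \<in> E \<Longrightarrow> u \<in> \<Union>\<S> \<Longrightarrow> v \<in> \<Union>\<S> \<Longrightarrow> \<exists>Z\<in>\<S>. u \<in> Z \<and> v \<in> Z"
  using assms
proof (induction rule: tdec.induct)
  case (join Y \<S> Z \<T>)
  have "(v, u) \<in> E" using join by (meson symD)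
  then have "(u \<in> \<Union>\<S> \<and> v \<in> \<Union>\<S>) \<or> (u \<in> \<Union>\<T> \<and> v \<in> \<Union>\<T>)" using join by blast
  then show ?case using join by blast
qed auto

text \<open>\<open>join\<close> glues only at roots; here the gluing happens at any bag
  \<open>Y\<close> of \<open>\<S>\<close>. The induction pushes \<open>\<T>\<close> into the half
  that contains \<open>Y\<close> and then repeats the old \<open>join\<close>.\<close>

lemma tdec_attach:
  assumes "tdec E R \<S>" "tdec E Z \<T>" "Y \<in> \<S>" "sym E" "\<Union>\<S> \<inter> \<Union>\<T> \<subseteq> Y \<inter> Z"
    and "E \<inter> (\<Union>\<S> - \<Union>\<T>) \<times> (\<Union>\<T> - \<Union>\<S>) = {}"
  shows "tdec E R (\<S> \<union> \<T>)"
  using assms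
proof (induction rule: tdec.induct)
  case (leaf R)
  then have "Y = R" by simp
  with leaf show ?case by (intro tdec.join[OF tdec.leaf]) auto
next
  case (join R \<S>1 R' \<S>2)
  have sy: "(u, v) \<in> E \<Longrightarrow> (v, u) \<in> E" for u v using \<open>sym E\<close> by (meson symD)
  define a b t where "a = \<Union>\<S>1" and "b = \<Union>\<S>2" and "t = \<Union>\<T>"
  have "R \<subseteq> a" "R' \<subseteq> b"
    unfolding a_def b_def
    by (rule Union_upper[OF tdec_root[OF join.hyps(1)]], rule Union_upper[OF tdec_root[OF join.hyps(2)]])
  moreover have "a \<inter> b \<subseteq> R \<inter> R'"
    unfolding a_def b_def by (rule join.hyps(3))
  moreover have "(a \<union> b) \<inter> t \<subseteq> Y \<inter> Z"
    using join.prems(4) unfolding a_def b_def t_def Union_Un_distrib .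
  ultimately have abt: "a \<inter> b \<subseteq> R \<inter> R'" "(a \<union> b) \<inter> t \<subseteq> Y \<inter> Z" "R \<subseteq> a" "R' \<subseteq> b"
    by simp_all
  have e1: "u \<in> b \<or> v \<in> a" if "(u, v) \<in> E" "u \<in> a" "v \<in> b" for u v
    using that join.hyps(4)[folded a_def b_def] by auto
  have e2: "u \<in> t \<or> v \<in> a \<union> b" if "(u, v) \<in> E" "u \<in> a \<union> b" "v \<in> t" for u v
    using that join.prems(5)[unfolded Union_Un_distrib, folded a_def b_def t_def] by auto
  consider "Y \<in> \<S>1" | "Y \<in> \<S>2" using join.prems(2) by blast
  then show ?case
  proof cases
    case 1
    then have "Y \<subseteq> a" unfolding a_def by (rule Union_upper)
    have "tdec E R (\<S>1 \<union> \<T>)"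
    proof (rule join.IH(1)[OF join.prems(1) 1 join.prems(3)]; fold a_def b_def t_def)
      show "a \<inter> t \<subseteq> Y \<inter> Z" using abt by auto
      show "E \<inter> (a - t) \<times> (t - a) = {}"
      proof (rule equals0I)
        fix e assume "e \<in> E \<inter> (a - t) \<times> (t - a)"
        then obtain u v where "(u, v) \<in> E" "u \<in> a" "u \<notin> t" "v \<in> t" "v \<notin> a" by auto
        then show False using e2[of u v] abt(2) \<open>Y \<subseteq> a\<close> by auto
      qed
    qed
    then have "tdec E R ((\<S>1 \<union> \<T>) \<union> \<S>2)"
    proof (rule tdec.join[OF _ join.hyps(2)]; unfold Union_Un_distrib; fold a_def b_def t_def)
      show "(a \<union> t) \<inter> b \<subseteq> R \<inter> R'"
        using abt \<open>Y \<subseteq> a\<close> by auto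
      show "E \<inter> ((a \<union> t) - b) \<times> (b - (a \<union> t)) = {}"
      proof (rule equals0I)
        fix e assume "e \<in> E \<inter> ((a \<union> t) - b) \<times> (b - (a \<union> t))"
        then obtain u v where "(u, v) \<in> E" "u \<in> a \<union> t" "u \<notin> b" "v \<in> b" "v \<notin> a" "v \<notin> t" by auto
        then show False using e1[of u v] e2[of v u] sy[of u v] by auto
      qed
    qed
    then show ?thesis by (simp add: Un_ac)
  next
    case 2
    then have "Y \<subseteq> b" unfolding b_def by (rule Union_upper)
    have "tdec E R' (\<S>2 \<union> \<T>)"
    proof (rule join.IH(2)[OF join.prems(1) 2 join.prems(3)]; fold a_def b_def t_def)
      show "b \<inter> t \<subseteq> Y \<inter> Z" using abt by auto
      show "E \<inter> (b - t) \<times> (t - b) = {}"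
      proof (rule equals0I)
        fix e assume "e \<in> E \<inter> (b - t) \<times> (t - b)"
        then obtain u v where "(u, v) \<in> E" "u \<in> b" "u \<notin> t" "v \<in> t" "v \<notin> b" by auto
        then show False using e2[of u v] abt(2) \<open>Y \<subseteq> b\<close> by auto
      qed
    qed
    then have "tdec E R (\<S>1 \<union> (\<S>2 \<union> \<T>))"
    proof (rule tdec.join[OF join.hyps(1)]; unfold Union_Un_distrib; fold a_def b_def t_def)
      show "a \<inter> (b \<union> t) \<subseteq> R \<inter> R'"
        using abt \<open>Y \<subseteq> b\<close> by auto
      show "E \<inter> (a - (b \<union> t)) \<times> ((b \<union> t) - a) = {}"
      proof (rule equals0I)
        fix e assume "e \<in> E \<inter> (a - (b \<union> t)) \<times> ((b \<union> t) - a)"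
        then obtain u v where "(u, v) \<in> E" "u \<in> a" "u \<notin> b" "u \<notin> t" "v \<in> b \<union> t" "v \<notin> a" by auto
        then show False using e1[of u v] e2[of u v] abt(2) \<open>Y \<subseteq> b\<close> by auto
      qed
    qed
    then show ?thesis by (simp add: Un_ac)
  qed
qed

text \<open>If the new root lies in the second half, that half is rerooted and the first half
  becomes a subtree attached at the old root \<open>Y'\<close> of the second.\<close>

lemma tdec_reroot:
  assumes "tdec E Y \<S>" "sym E" "Z \<in> \<S>"
  shows "tdec E Z \<S>"
  using assms
proof (induction arbitrary: Z rule: tdec.induct)
  case (leaf Y) then show ?case by (simp add: tdec.leaf)
next
  case (join Y \<S> Y' \<T>)
  from join.prems(2) show ?case
  proof
    assume "Z \<in> \<S>"
    then have "tdec E Z \<S>" using join.IH(1) \<open>sym E\<close> by simp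
    then show ?thesis
      by (rule tdec_attach[OF _ join.hyps(2) tdec_root[OF join.hyps(1)] \<open>sym E\<close> join.hyps(3,4)])
  next
    assume "Z \<in> \<T>"
    then have "tdec E Z \<T>" using join.IH(2) \<open>sym E\<close> by simp
    then have "tdec E Z (\<T> \<union> \<S>)"
    proof (rule tdec_attach[OF _ join.hyps(1) tdec_root[OF join.hyps(2)] \<open>sym E\<close>])
      show "\<Union>\<T> \<inter> \<Union>\<S> \<subseteq> Y' \<inter> Y" using join.hyps(3) by (simp add: Int_commute)
      show "E \<inter> (\<Union>\<T> - \<Union>\<S>) \<times> (\<Union>\<S> - \<Union>\<T>) = {}"
      proof (rule equals0I)
        fix e assume "e \<in> E \<inter> (\<Union>\<T> - \<Union>\<S>) \<times> (\<Union>\<S> - \<Union>\<T>)"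
        then obtain u v where "e = (u, v)" "(v, u) \<in> E \<inter> (\<Union>\<S> - \<Union>\<T>) \<times> (\<Union>\<T> - \<Union>\<S>)"
          using symD[OF \<open>sym E\<close>] by (cases e) simp
        then show False using join.hyps(4) by (metis empty_iff)
      qed
    qed
    then show ?thesis by (simp add: Un_commute)
  qed
qed

section \<open>Bramble duality\<close>

text \<open>The component is the union of all connected subsets of \<open>R\<close> through
  \<open>v\<close>. They share \<open>v\<close>, so the union is connected, and by
  \<open>conn_insert_adjacent\<close> it absorbs every neighbour in \<open>R\<close>.\<close>

lemma component_exists:
  assumes "sym E" "v \<in> R"
  obtains C where "C \<subseteq> R" "v \<in> C" "conn E C" "\<And>x y. (x, y) \<in> E \<Longrightarrow> x \<in> C \<Longrightarrow> y \<in> R \<Longrightarrow> y \<in> C"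
    "\<And>D. conn E D \<Longrightarrow> D \<subseteq> R \<Longrightarrow> v \<in> D \<Longrightarrow> D \<subseteq> C"
proof
  let ?\<F> = "{D. D \<subseteq> R \<and> v \<in> D \<and> conn E D}"
  have v: "{v} \<in> ?\<F>" using assms(2) conn_singleton by simp
  show "\<Union>?\<F> \<subseteq> R" by blast
  show "v \<in> \<Union>?\<F>" using v by blast
  show c: "conn E (\<Union>?\<F>)"
  proof (rule conn_Union)
    show "?\<F> \<noteq> {}" using v by blast
    show "touch E B C" if "B \<in> ?\<F>" "C \<in> ?\<F>" for B C using that unfolding touch_def by blast
  qed simp
  show "y \<in> \<Union>?\<F>" if "(x, y) \<in> E" "x \<in> \<Union>?\<F>" "y \<in> R" for x y
  proof -
    have "conn E (insert y (\<Union>?\<F>))" by (rule conn_insert_adjacent[OF assms(1) c that(2,1)])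
    then have "insert y (\<Union>?\<F>) \<in> ?\<F>" using that(3) assms(2) v by blast
    then show ?thesis by blast
  qed
  show "D \<subseteq> \<Union>?\<F>" if "conn E D" "D \<subseteq> R" "v \<in> D" for D using that by blast
qed

text \<open>A bag may be too large as long as it fails to cover the bramble. This weakening makes
  duality provable by enlarging the bramble; for the empty bramble it means small bags only.\<close>

definition admissible :: "nat \<Rightarrow> 'a set set \<Rightarrow> 'a set \<Rightarrow> bool" where
  "admissible k \<B> Z \<longleftrightarrow> card Z \<le> k \<or> (\<exists>B\<in>\<B>. B \<inter> Z = {})"

text \<open>
  The inductive step of bramble duality: \<open>X\<close> is a minimum cover of the bramble, \<open>C\<close> a component
  outside \<open>X\<close>, and \<open>Y\<close> a bag that covers the bramble and is made the root. A bag \<open>Z\<close> whose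
  subtree has union \<open>A\<close> is replaced by \<open>(Z \<inter> C) \<union> (X \<inter> A)\<close>. No bag grows, because exchanging
  \<open>X \<inter> A\<close> for \<open>Z - C\<close> in \<open>X\<close> yields another cover.
\<close>

locale cover_component =
  fixes E :: "'a rel" and \<B> :: "'a set set" and X C Y :: "'a set" and k :: nat
  assumes sym: "sym E"
    and conn_in: "\<And>B. B \<in> \<B> \<Longrightarrow> conn E B"
    and finite_X: "finite X" and card_X: "card X \<le> k"
    and cover_X: "\<And>B. B \<in> \<B> \<Longrightarrow> B \<inter> X \<noteq> {}"
    and minimal_X: "\<And>W. finite W \<Longrightarrow> (\<And>B. B \<in> \<B> \<Longrightarrow> B \<inter> W \<noteq> {}) \<Longrightarrow> card X \<le> card W"
    and C_X: "C \<inter> X = {}"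
    and neighbours_C: "\<And>u v. (u, v) \<in> E \<Longrightarrow> v \<in> C \<Longrightarrow> u \<in> C \<union> X"
    and cover_Y: "\<And>B. B \<in> \<B> \<Longrightarrow> B \<inter> Y \<noteq> {}"
    and C_Y: "C \<inter> Y = {}"
begin

text \<open>\<open>X\<close> is a minimum cover, so it suffices that
  \<open>(X - A) \<union> (Z - C)\<close> is a cover too. An element missing it would run from
  \<open>X \<inter> A\<close> to a vertex of \<open>Y\<close> outside \<open>C \<union> A\<close>.
  Where it leaves \<open>C \<union> A\<close>, it either steps from \<open>C\<close> into
  \<open>X - A\<close> or starts from a vertex of \<open>Z - C\<close>.\<close>

lemma card_X_inter_le:
  assumes "finite Z" "Y \<inter> A \<subseteq> Z" and sep: "\<And>u v. (u, v) \<in> E \<Longrightarrow> u \<notin> A \<Longrightarrow> v \<in> A \<Longrightarrow> v \<in> Z"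
  shows "card (X \<inter> A) \<le> card (Z - C)"
proof -
  let ?W = "(X - A) \<union> (Z - C)"
  have "card X \<le> card ?W"
  proof (rule minimal_X)
    show "finite ?W" using finite_X assms(1) by simp
    fix B assume B: "B \<in> \<B>"
    show "B \<inter> ?W \<noteq> {}"
    proof
      assume disj: "B \<inter> ?W = {}"
      obtain x where x: "x \<in> B" "x \<in> X" using cover_X[OF B] by blast
      obtain y where y: "y \<in> B" "y \<in> Y" using cover_Y[OF B] by blast
      have "x \<in> C \<union> A" using x disj by blast
      moreover have "y \<notin> C \<union> A" using y disj C_Y assms(2) by blast
      ultimately obtain v u where uv: "v \<in> B" "v \<in> C \<union> A" "u \<in> B" "u \<notin> C \<union> A" "(v, u) \<in> E"
        by (rule conn_exitE[OF conn_in[OF B] x(1) _ y(1)])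
      have e: "(u, v) \<in> E" by (rule symD[OF sym uv(5)])
      show False
      proof (cases "v \<in> C")
        case True
        then have "u \<in> X" using neighbours_C[OF e] uv(4) by blast
        then show False using disj uv(3,4) by blast
      next
        case False
        then have "v \<in> Z" using sep[OF e] uv(2,4) by blast
        then show False using False disj uv(1) by blast
      qed
    qed
  qed
  also have "\<dots> \<le> card (X - A) + card (Z - C)" by (rule card_Un_le)
  finally show ?thesis
    using card_Int_Diff[OF finite_X, of A] by linarith
qed

text \<open>A small \<open>Z\<close> stays small by \<open>card_X_inter_le\<close>; if
  \<open>Z\<close> misses \<open>C\<close>, the new bag lies in \<open>X\<close>. If
  \<open>Z\<close> misses some \<open>B\<close> in \<open>\<B>\<close>, then \<open>B\<close> misses
  all of \<open>A\<close>, because it reaches \<open>Y\<close> outside \<open>A\<close> and could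
  enter \<open>A\<close> only through \<open>Z\<close>.\<close>

lemma admissible_shift:
  assumes "finite Z" "Y \<inter> A \<subseteq> Z" "Z \<subseteq> A"
    and sep: "\<And>u v. (u, v) \<in> E \<Longrightarrow> u \<notin> A \<Longrightarrow> v \<in> A \<Longrightarrow> v \<in> Z"
    and adm: "admissible k (insert C \<B>) Z"
  shows "admissible k \<B> (Z \<inter> C \<union> X \<inter> A)"
proof -
  have "card (Z \<inter> C \<union> X \<inter> A) \<le> card (Z \<inter> C) + card (X \<inter> A)" by (rule card_Un_le)
  also have "\<dots> \<le> card (Z \<inter> C) + card (Z - C)"
    using card_X_inter_le[OF assms(1,2) sep] by simp
  also have "\<dots> = card Z" using assms(1) by (metis card_Int_Diff)
  finally have le: "card (Z \<inter> C \<union> X \<inter> A) \<le> card Z" .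
  consider "card Z \<le> k" | "C \<inter> Z = {}" | B where "B \<in> \<B>" "B \<inter> Z = {}"
    using adm unfolding admissible_def by blast
  then show ?thesis
  proof cases
    case 1 then show ?thesis using le unfolding admissible_def by simp
  next
    case 2
    then have "Z \<inter> C \<union> X \<inter> A \<subseteq> X" by blast
    then have "card (Z \<inter> C \<union> X \<inter> A) \<le> card X" using finite_X card_mono by blast
    then show ?thesis using card_X unfolding admissible_def by simp
  next
    case 3
    have "B \<inter> A = {}"
    proof (rule ccontr)
      assume "B \<inter> A \<noteq> {}"
      then obtain x where x: "x \<in> B" "x \<in> A" by blast
      obtain y where y: "y \<in> B" "y \<in> Y" using cover_Y[OF 3(1)] by blast
      have "y \<notin> A" using y 3 assms(2) by blast
      then obtain v u where "v \<in> B" "v \<in> A" "u \<notin> A" "(v, u) \<in> E"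
        using conn_exitE[OF conn_in[OF 3(1)] x y(1)] by metis
      then have "v \<in> Z" using sep[of u v] sym by (meson symD)
      then show False using 3 \<open>v \<in> B\<close> by blast
    qed
    then have "B \<inter> (Z \<inter> C \<union> X \<inter> A) = {}" using assms(3) by blast
    then show ?thesis using 3(1) unfolding admissible_def by blast
  qed
qed

text \<open>
  \<open>X0\<close> leaves room for the vertices of \<open>X\<close> in those subtrees that are attached to the root later.
\<close>

lemma tdec_shift:
  assumes "tdec E Z \<T>" "\<And>W. W \<in> \<T> \<Longrightarrow> finite W" "Y \<inter> \<Union>\<T> \<subseteq> Z"
    and "\<And>u v. (u, v) \<in> E \<Longrightarrow> u \<notin> \<Union>\<T> \<Longrightarrow> v \<in> \<Union>\<T> \<Longrightarrow> v \<in> Z"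
    and "\<And>W. W \<in> \<T> \<Longrightarrow> admissible k (insert C \<B>) W"
    and "X \<inter> \<Union>\<T> \<subseteq> X0" "X0 \<subseteq> X" "admissible k \<B> (Z \<inter> C \<union> X0)"
  shows "\<exists>\<T>'. tdec E (Z \<inter> C \<union> X0) \<T>' \<and> \<Union>\<T>' = \<Union>\<T> \<inter> C \<union> X0 \<and> (\<forall>W\<in>\<T>'. admissible k \<B> W)"
  using assms
proof (induction arbitrary: X0 rule: tdec.induct)
  case (leaf Z)
  then show ?case by (intro exI[of _ "{Z \<inter> C \<union> X0}"]) (auto intro: tdec.leaf)
next
  case (join Z \<S> Z' \<T>)
  define a b where "a = \<Union>\<S>" and "b = \<Union>\<T>"
  have roots: "Z \<subseteq> a" "Z' \<subseteq> b"
    unfolding a_def b_def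
    by (rule Union_upper[OF tdec_root[OF join.hyps(1)]], rule Union_upper[OF tdec_root[OF join.hyps(2)]])
  have ab: "a \<inter> b \<subseteq> Z \<inter> Z'" unfolding a_def b_def by (rule join.hyps(3))
  have e: "u \<in> b \<or> v \<in> a" if "(u, v) \<in> E" "u \<in> a" "v \<in> b" for u v
    using that join.hyps(4)[folded a_def b_def] by auto
  note sep = join.prems(3)[unfolded Union_Un_distrib, folded a_def b_def]
  note Y = join.prems(2)[unfolded Union_Un_distrib, folded a_def b_def]
  note X0 = join.prems(5)[unfolded Union_Un_distrib, folded a_def b_def]
  have sep_a: "v \<in> Z" if "(u, v) \<in> E" "u \<notin> a" "v \<in> a" for u v
    using sep[of u v] e[of v u] that ab symD[OF sym that(1)] by blast
  have sep_b: "v \<in> Z'" if "(u, v) \<in> E" "u \<notin> b" "v \<in> b" for u v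
    using sep[of u v] e[of u v] that ab roots by blast
  have "\<exists>\<S>'. tdec E (Z \<inter> C \<union> X0) \<S>' \<and> \<Union>\<S>' = a \<inter> C \<union> X0 \<and> (\<forall>W\<in>\<S>'. admissible k \<B> W)"
  proof (rule join.IH(1)[folded a_def])
    show "Y \<inter> a \<subseteq> Z" using Y by blast
    show "X \<inter> a \<subseteq> X0" using X0 by blast
  qed (use join.prems sep_a in auto)
  then obtain \<S>' where S': "tdec E (Z \<inter> C \<union> X0) \<S>'" "\<Union>\<S>' = a \<inter> C \<union> X0"
    "\<forall>W\<in>\<S>'. admissible k \<B> W" by blast
  have Yb: "Y \<inter> b \<subseteq> Z'" using Y ab roots by blast
  \<comment> \<open>The half of the root carries all of \<open>X0\<close>. The other half receives
    only \<open>X \<inter> b\<close>, for which \<open>admissible_shift\<close> supplies the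
    condition on its root bag.\<close>
  have "\<exists>\<T>'. tdec E (Z' \<inter> C \<union> X \<inter> b) \<T>' \<and> \<Union>\<T>' = b \<inter> C \<union> X \<inter> b \<and> (\<forall>W\<in>\<T>'. admissible k \<B> W)"
  proof (rule join.IH(2)[folded b_def])
    show "admissible k \<B> (Z' \<inter> C \<union> X \<inter> b)"
      using join.prems(1,4) tdec_root[OF join.hyps(2)] Yb roots(2) sep_b by (intro admissible_shift) auto
  qed (use join.prems sep_b Yb in auto)
  then obtain \<T>' where T': "tdec E (Z' \<inter> C \<union> X \<inter> b) \<T>'" "\<Union>\<T>' = b \<inter> C \<union> X \<inter> b"
    "\<forall>W\<in>\<T>'. admissible k \<B> W" by blast
  have "tdec E (Z \<inter> C \<union> X0) (\<S>' \<union> \<T>')"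
  proof (rule tdec.join[OF S'(1) T'(1)]; unfold S'(2) T'(2))
    show "(a \<inter> C \<union> X0) \<inter> (b \<inter> C \<union> X \<inter> b) \<subseteq> (Z \<inter> C \<union> X0) \<inter> (Z' \<inter> C \<union> X \<inter> b)"
      using ab X0 join.prems(6) C_X by blast
    show "E \<inter> ((a \<inter> C \<union> X0) - (b \<inter> C \<union> X \<inter> b)) \<times> ((b \<inter> C \<union> X \<inter> b) - (a \<inter> C \<union> X0)) = {}"
    proof (rule equals0I)
      fix p assume "p \<in> E \<inter> ((a \<inter> C \<union> X0) - (b \<inter> C \<union> X \<inter> b)) \<times> ((b \<inter> C \<union> X \<inter> b) - (a \<inter> C \<union> X0))"
      then obtain u v where uv: "(u, v) \<in> E" "u \<in> a \<inter> C \<union> X0" "u \<notin> b \<inter> C \<union> X \<inter> b"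
        "v \<in> b \<inter> C \<union> X \<inter> b" "v \<notin> a \<inter> C \<union> X0" by auto
      have "v \<in> b" "v \<in> C" "v \<notin> a" "u \<notin> b" using uv X0 join.prems(6) by auto
      then show False using e[OF uv(1)] sep[OF uv(1)] roots(1) by blast
    qed
  qed
  moreover have "\<Union>(\<S>' \<union> \<T>') = \<Union>(\<S> \<union> \<T>) \<inter> C \<union> X0"
    unfolding Union_Un_distrib S'(2) T'(2) a_def[symmetric] b_def[symmetric] using X0 by blast
  ultimately show ?case using S'(3) T'(3) by blast
qed

end

lemma bramble_insert:
  assumes "sym E" "bramble E \<B>" "conn E C" "\<And>B. B \<in> \<B> \<Longrightarrow> touch E B C"
  shows "bramble E (insert C \<B>)"
  using assms touch_sym[OF assms(1)] touch_self[OF conn_nonempty[OF assms(3)]]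
  unfolding bramble_def by blast

text \<open>Induction on the number of sets that are not yet in the bramble. With \<open>X\<close> a
  minimum cover, the components \<open>C\<close> of \<open>V - X\<close> are decomposed separately,
  with root bag \<open>X\<close>, and glued there. If some bramble element does not touch
  \<open>C\<close>, then \<open>C\<close> with its neighbours is a single bag missing that element.
  Otherwise \<open>C\<close> enlarges the bramble, and the decomposition obtained for the larger one
  is shifted onto \<open>X \<union> C\<close>.\<close>

lemma bramble_admissible_tdec:
  assumes "finite V" "sym E" "E \<subseteq> V \<times> V"
    and small: "\<And>\<B>. bramble E \<B> \<Longrightarrow> \<Union>\<B> \<subseteq> V \<Longrightarrow> \<not> order_exceeds \<B> k"
    and "bramble E \<B>" "\<Union>\<B> \<subseteq> V"
  shows "\<exists>Y \<T>. tdec E Y \<T> \<and> \<Union>\<T> = V \<and> (\<forall>Z\<in>\<T>. admissible k \<B> Z)"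
  using assms(5,6)
proof (induction "card (Pow V - \<B>)" arbitrary: \<B> rule: less_induct)
  case less
  let ?cover = "\<lambda>W. finite W \<and> (\<forall>B\<in>\<B>. B \<inter> W \<noteq> {})"
  obtain X0 where X0: "?cover X0" "card X0 \<le> k"
    using small[OF less.prems] unfolding order_exceeds_def by blast
  obtain X where "?cover X" and X_min: "\<And>W. ?cover W \<Longrightarrow> card X \<le> card W"
    using exists_least_iff[of "\<lambda>n. \<exists>W. ?cover W \<and> card W = n"] X0(1)
    by (metis (no_types, lifting) not_le_imp_less)
  have X_V: "X \<subseteq> V"
  proof -
    have "?cover (X \<inter> V)" using \<open>?cover X\<close> less.prems(2) by blast
    then have "card X \<le> card (X \<inter> V)" by (rule X_min)
    then have "X \<inter> V = X" using \<open>?cover X\<close> by (intro card_seteq) auto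
    then show ?thesis by blast
  qed
  have X_k: "card X \<le> k" using X_min[OF X0(1)] X0(2) by simp
  then have adm_X: "admissible k \<B> X" unfolding admissible_def by simp
  show ?case
  proof (rule ccontr)
    assume none: "\<not> ?case"
    have part: "\<exists>\<T>. tdec E X \<T> \<and> \<Union>\<T> = X \<union> C \<and> (\<forall>Z\<in>\<T>. admissible k \<B> Z)"
      if C: "C \<subseteq> V - X" "conn E C" "\<And>x y. (x, y) \<in> E \<Longrightarrow> x \<in> C \<Longrightarrow> y \<in> V - X \<Longrightarrow> y \<in> C" for C
    proof -
      have nb: "u \<in> C \<union> X" if "(u, v) \<in> E" "v \<in> C" for u v
        using C(3)[of v u] that assms(3) symD[OF assms(2) that(1)] by blast
      show ?thesis
      proof (cases "\<forall>B\<in>\<B>. touch E B C")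
        case False
        then obtain B where B: "B \<in> \<B>" "\<not> touch E B C" by blast
        define W where "W = C \<union> {u \<in> X. \<exists>v\<in>C. (u, v) \<in> E}"
        have "B \<inter> W = {}" using B(2) unfolding W_def touch_def by blast
        then have "admissible k \<B> W" using B(1) unfolding admissible_def by blast
        moreover have "tdec E X ({X} \<union> {W})"
        proof (rule tdec.join[OF tdec.leaf tdec.leaf])
          show "E \<inter> (\<Union>{X} - \<Union>{W}) \<times> (\<Union>{W} - \<Union>{X}) = {}"
            unfolding W_def by auto
        qed simp
        ultimately show ?thesis using adm_X
          by (intro exI[of _ "{X} \<union> {W}"]) (auto simp: W_def)
      next
        case True
        have "C \<notin> \<B>" using \<open>?cover X\<close> C(1) by blast
        have br: "bramble E (insert C \<B>)"
          using bramble_insert[OF assms(2) less.prems(1) C(2)] True by blast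
        have "\<exists>Y \<T>. tdec E Y \<T> \<and> \<Union>\<T> = V \<and> (\<forall>Z\<in>\<T>. admissible k (insert C \<B>) Z)"
        proof (rule less.hyps[OF _ br])
          have "Pow V - insert C \<B> \<subset> Pow V - \<B>" using \<open>C \<notin> \<B>\<close> C(1) by blast
          then show "card (Pow V - insert C \<B>) < card (Pow V - \<B>)"
            using assms(1) by (intro psubset_card_mono) auto
          show "\<Union>(insert C \<B>) \<subseteq> V" using C(1) less.prems(2) by blast
        qed
        then obtain Y0 \<T> where T: "tdec E Y0 \<T>" "\<Union>\<T> = V" "\<And>Z. Z \<in> \<T> \<Longrightarrow> admissible k (insert C \<B>) Z"
          by blast
        \<comment> \<open>By the assumption \<open>none\<close> some bag is inadmissible for
          \<open>\<B>\<close>: it has more than \<open>k\<close> vertices and covers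
          \<open>\<B>\<close>. Its admissibility for \<open>insert C \<B>\<close> can then come only
          from missing \<open>C\<close>.\<close>
        obtain Y where Y: "Y \<in> \<T>" "\<not> admissible k \<B> Y" using none T by blast
        have Y_C: "C \<inter> Y = {}" and Y_cover: "\<forall>B\<in>\<B>. B \<inter> Y \<noteq> {}"
          using T(3)[OF Y(1)] Y(2) unfolding admissible_def by auto
        interpret cover_component E \<B> X C Y k
        proof
          show "conn E B" if "B \<in> \<B>" for B using that less.prems(1) unfolding bramble_def by blast
          show "card X \<le> card W" if "finite W" "\<And>B. B \<in> \<B> \<Longrightarrow> B \<inter> W \<noteq> {}" for W
            using X_min that by blast
        qed (use assms(2) \<open>?cover X\<close> X_k C(1) nb Y_C Y_cover in auto)
        have "Y \<inter> C \<union> X = X" using Y_C by blast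
        have "\<exists>\<T>'. tdec E (Y \<inter> C \<union> X) \<T>' \<and> \<Union>\<T>' = \<Union>\<T> \<inter> C \<union> X \<and> (\<forall>W\<in>\<T>'. admissible k \<B> W)"
        proof (rule tdec_shift)
          show "tdec E Y \<T>" by (rule tdec_reroot[OF T(1) assms(2) Y(1)])
          show "finite W" if "W \<in> \<T>" for W
            using that T(2) assms(1) by (meson Union_upper finite_subset)
          show "v \<in> Y" if "(u, v) \<in> E" "u \<notin> \<Union>\<T>" for u v
            using that T(2) assms(3) by blast
          show "admissible k \<B> (Y \<inter> C \<union> X)" using adm_X \<open>Y \<inter> C \<union> X = X\<close> by simp
        qed (use T in auto)
        moreover have "\<Union>\<T> \<inter> C \<union> X = X \<union> C" using T(2) C(1) by blast
        ultimately show ?thesis using \<open>Y \<inter> C \<union> X = X\<close> by simp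
      qed
    qed
    \<comment> \<open>Components of \<open>V - X\<close> are split off one at a time; no edges run
      between them, and all parts have root \<open>X\<close>.\<close>
    have glue: "\<exists>\<T>. tdec E X \<T> \<and> \<Union>\<T> = X \<union> R \<and> (\<forall>Z\<in>\<T>. admissible k \<B> Z)"
      if "R \<subseteq> V - X" "\<And>x y. (x, y) \<in> E \<Longrightarrow> x \<in> R \<Longrightarrow> y \<in> V - X \<Longrightarrow> y \<in> R" for R
      using that
    proof (induction "card R" arbitrary: R rule: less_induct)
      case (less R)
      show ?case
      proof (cases "R = {}")
        case True
        then show ?thesis using adm_X by (intro exI[of _ "{X}"]) (auto intro: tdec.leaf)
      next
        case False
        then obtain v where "v \<in> R" by blast
        then obtain C where C: "C \<subseteq> R" "v \<in> C" "conn E C"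
          "\<And>x y. (x, y) \<in> E \<Longrightarrow> x \<in> C \<Longrightarrow> y \<in> R \<Longrightarrow> y \<in> C"
          using component_exists[OF assms(2)] by metis
        have closed_C: "y \<in> C" if "(x, y) \<in> E" "x \<in> C" "y \<in> V - X" for x y
          using C(1) C(4)[OF that(1,2)] less.prems(2)[OF that(1)] that by blast
        have "\<exists>\<S>. tdec E X \<S> \<and> \<Union>\<S> = X \<union> C \<and> (\<forall>Z\<in>\<S>. admissible k \<B> Z)"
          by (rule part[OF subset_trans[OF C(1) less.prems(1)] C(3)]) (rule closed_C)
        then obtain \<S> where S: "tdec E X \<S>" "\<Union>\<S> = X \<union> C" "\<forall>Z\<in>\<S>. admissible k \<B> Z"
          by blast
        have fR: "finite R"
          by (rule finite_subset[OF less.prems(1)]) (simp add: assms(1))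
        have "\<exists>\<T>. tdec E X \<T> \<and> \<Union>\<T> = X \<union> (R - C) \<and> (\<forall>Z\<in>\<T>. admissible k \<B> Z)"
        proof (rule less.hyps)
          show "card (R - C) < card R" using C(1,2) fR by (intro psubset_card_mono) auto
          show "y \<in> R - C" if "(x, y) \<in> E" "x \<in> R - C" "y \<in> V - X" for x y
            using less.prems(2)[OF that(1)] C(4)[of y x] symD[OF assms(2) that(1)] that by blast
        qed (use less.prems(1) in blast)
        then obtain \<T> where T: "tdec E X \<T>" "\<Union>\<T> = X \<union> (R - C)" "\<forall>Z\<in>\<T>. admissible k \<B> Z" by blast
        have "tdec E X (\<S> \<union> \<T>)"
        proof (rule tdec.join[OF S(1) T(1)]; unfold S(2) T(2))
          show "E \<inter> (X \<union> C - (X \<union> (R - C))) \<times> (X \<union> (R - C) - (X \<union> C)) = {}"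
            using C(4) by auto
        qed blast
        moreover have "\<Union>(\<S> \<union> \<T>) = X \<union> R"
          unfolding Union_Un_distrib S(2) T(2) using C(1) by blast
        ultimately show ?thesis using S(3) T(3) by blast
      qed
    qed
    have "\<exists>\<T>. tdec E X \<T> \<and> \<Union>\<T> = X \<union> (V - X) \<and> (\<forall>Z\<in>\<T>. admissible k \<B> Z)"
      by (rule glue) auto
    then show False using none X_V by (metis Un_Diff_cancel sup.absorb2)
  qed
qed

text \<open>The case of the empty bramble, where \<open>admissible\<close> leaves only the bound on
  the size.\<close>

theorem tdec_if_no_bramble:
  assumes "finite V" "sym E" "E \<subseteq> V \<times> V"
    and "\<And>\<B>. bramble E \<B> \<Longrightarrow> \<Union>\<B> \<subseteq> V \<Longrightarrow> \<not> order_exceeds \<B> k"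
  obtains Y \<T> where "tdec E Y \<T>" "\<Union>\<T> = V" "\<And>Z. Z \<in> \<T> \<Longrightarrow> card Z \<le> k"
proof -
  have "\<exists>Y \<T>. tdec E Y \<T> \<and> \<Union>\<T> = V \<and> (\<forall>Z\<in>\<T>. admissible k {} Z)"
    using assms by (intro bramble_admissible_tdec) (auto simp: bramble_def)
  then show thesis using that unfolding admissible_def by auto
qed

section \<open>Brambles in graphs with small cutsizes\<close>

lemma order_exceeds_mono: "order_exceeds \<B> k \<Longrightarrow> l \<le> k \<Longrightarrow> order_exceeds \<B> l"
  unfolding order_exceeds_def by (meson le_trans)

lemma order_exceeds_avoid:
  assumes "order_exceeds \<B> (p + j)" "finite S" "card S \<le> j"
  shows "order_exceeds {B \<in> \<B>. B \<inter> S = {}} p"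
  unfolding order_exceeds_def
proof (intro allI impI)
  fix X :: "'a set" assume X: "finite X \<and> card X \<le> p"
  have "card (X \<union> S) \<le> p + j" using card_Un_le[of X S] X assms(3) by linarith
  then obtain B where "B \<in> \<B>" "B \<inter> (X \<union> S) = {}"
    using assms(1,2) X unfolding order_exceeds_def by (meson finite_UnI)
  then show "\<exists>B\<in>{B \<in> \<B>. B \<inter> S = {}}. B \<inter> X = {}" by blast
qed

lemma order_exceeds_nonempty: "order_exceeds \<B> k \<Longrightarrow> \<B> \<noteq> {}"
  unfolding order_exceeds_def by (metis card.empty empty_iff finite.emptyI le0)

lemma order_exceeds_less_card_Union:
  assumes "order_exceeds \<B> k" "finite (\<Union>\<B>)" "\<And>B. B \<in> \<B> \<Longrightarrow> B \<noteq> {}"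
  shows "k < card (\<Union>\<B>)"
proof (rule ccontr)
  assume "\<not> k < card (\<Union>\<B>)"
  then obtain B where "B \<in> \<B>" "B \<inter> \<Union>\<B> = {}"
    using assms(1,2) unfolding order_exceeds_def by (meson not_less)
  then show False using assms(3) by blast
qed

lemma bramble_subset: "bramble E \<B> \<Longrightarrow> \<C> \<subseteq> \<B> \<Longrightarrow> bramble E \<C>"
  unfolding bramble_def by blast

lemma bramble_conn_Union: "bramble E \<B> \<Longrightarrow> \<B> \<noteq> {} \<Longrightarrow> conn E (\<Union>\<B>)"
  unfolding bramble_def by (intro conn_Union) auto

text \<open>The inner vertex boundary of \<open>C\<close> in the graph on \<open>H\<close>. With
  \<open>C\<close> as source side of a cut, it is the separator through which all flow to
  \<open>H - C\<close> must pass.\<close>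

definition boundary :: "'a rel \<Rightarrow> 'a set \<Rightarrow> 'a set \<Rightarrow> 'a set" where
  "boundary E H C = {v \<in> C. \<exists>y\<in>H - C. (v, y) \<in> E}"

lemma boundary_subset: "boundary E H C \<subseteq> C"
  unfolding boundary_def by blast

text \<open>Adding the sizes of the union and of the intersection of two boundaries turns the claim
  into two inclusions that hold vertex by vertex.\<close>

lemma boundary_submodular:
  assumes "finite C" "finite D"
  shows "card (boundary E H (C \<union> D)) + card (boundary E H (C \<inter> D))
    \<le> card (boundary E H C) + card (boundary E H D)"
proof -
  let ?b = "boundary E H"
  have fin: "finite (?b A)" if "finite A" for A
    using that boundary_subset finite_subset by metis
  have "card (?b (C \<union> D)) + card (?b (C \<inter> D))
      = card (?b (C \<union> D) \<union> ?b (C \<inter> D)) + card (?b (C \<union> D) \<inter> ?b (C \<inter> D))"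
    using assms by (intro card_Un_Int fin) auto
  also have "\<dots> \<le> card (?b C \<union> ?b D) + card (?b C \<inter> ?b D)"
  proof (intro add_mono card_mono)
    show "?b (C \<union> D) \<union> ?b (C \<inter> D) \<subseteq> ?b C \<union> ?b D" unfolding boundary_def by auto
    show "?b (C \<union> D) \<inter> ?b (C \<inter> D) \<subseteq> ?b C \<inter> ?b D" unfolding boundary_def by auto
  qed (use assms fin in auto)
  also have "\<dots> = card (?b C) + card (?b D)"
    using assms fin by (intro card_Un_Int[symmetric]) auto
  finally show ?thesis .
qed

text \<open>If \<open>B\<close> met \<open>C\<close>, it would lie inside \<open>C\<close>, as it
  cannot leave without using the boundary; then touching \<open>B'\<close> outside \<open>C\<close>
  again needs a boundary vertex. So the bramble elements avoiding a separator agree on the side they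
  are on.\<close>

lemma conn_misses_side:
  assumes "conn E B" "B \<subseteq> H" "B' \<subseteq> H" "touch E B B'" "B' \<inter> C = {}" "B \<inter> boundary E H C = {}"
  shows "B \<inter> C = {}"
proof (rule ccontr)
  assume "B \<inter> C \<noteq> {}"
  then obtain x where x: "x \<in> B" "x \<in> C" by blast
  have "B \<subseteq> C"
  proof
    fix y assume "y \<in> B"
    show "y \<in> C"
    proof (rule ccontr)
      assume "y \<notin> C"
      then obtain u v where "u \<in> B" "u \<in> C" "v \<in> B" "v \<notin> C" "(u, v) \<in> E"
        using conn_exitE[OF assms(1) x \<open>y \<in> B\<close>] by metis
      then show False using assms(2,6) unfolding boundary_def by blast
    qed
  qed
  then show False using assms(3-6) unfolding touch_def boundary_def by blast
qed

text \<open>\<open>m\<close> is the capacity of a vertex, \<open>M\<close> the number of units to be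
  sent, and separators below \<open>J\<close> count as small. The order \<open>2 * J\<close> allows
  one bramble element to avoid two small separators, and \<open>M_le\<close> forces saturated
  separators to be small. In \<open>capacity\<close>, units either start outside \<open>C\<close> or
  pass through its boundary.\<close>

locale routing =
  fixes E :: "'a rel" and V :: "'a set" and \<B> :: "'a set set" and m J M :: nat
  assumes finite_V: "finite V"
    and bramble: "bramble E \<B>" and Union_subset: "\<Union>\<B> \<subseteq> V"
    and order: "order_exceeds \<B> (2 * J)"
    and m_pos: "1 \<le> m" and M_le: "M \<le> m * J"
    and capacity: "\<And>C B. C \<subseteq> V \<Longrightarrow> B \<in> \<B> \<Longrightarrow> B \<inter> C = {} \<Longrightarrow> card (boundary E V C) < J \<Longrightarrow>
      M \<le> card (V - C) + m * card (boundary E V C)"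
begin

text \<open>
  \<open>routable U\<close> is the cut condition for sending one unit from each vertex of \<open>U\<close> to the bramble,
  with vertex capacities \<open>m\<close>, inside the subgraph induced by \<open>U\<close> and the bramble.
\<close>

definition routable :: "'a set \<Rightarrow> bool" where
  "routable U \<longleftrightarrow> (\<forall>C B. C \<subseteq> \<Union>\<B> \<union> U \<longrightarrow> B \<in> \<B> \<longrightarrow> B \<inter> C = {} \<longrightarrow>
     card (C \<inter> U) \<le> m * card (boundary E (\<Union>\<B> \<union> U) C))"

lemma routableD:
  assumes "routable U" "C \<subseteq> \<Union>\<B> \<union> U" "B \<in> \<B>" "B \<inter> C = {}"
  shows "card (C \<inter> U) \<le> m * card (boundary E (\<Union>\<B> \<union> U) C)"
  using assms unfolding routable_def by simp

text \<open>
  If no vertex can be added, then the union of all tight sets together with the vertices outside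
  violates the capacity condition. No flow is ever rerouted: a path that meets a vertex outside
  \<open>U\<close> may as well start there.
\<close>

lemma routable_extend:
  assumes "U \<subseteq> V" "routable U" "card U < M"
  shows "\<exists>x\<in>V - U. routable (insert x U)"
proof (rule ccontr)
  assume "\<not> ?thesis"
  then have bad: "\<not> routable (insert x U)" if "x \<in> V - U" for x using that by blast
  define H where "H = \<Union>\<B> \<union> U"
  have HV: "H \<subseteq> V" and fH: "finite H" and fU: "finite U" and UH: "U \<subseteq> H"
    using assms(1) Union_subset finite_V unfolding H_def by (auto intro: finite_subset)
  define avoid where "avoid C \<longleftrightarrow> (\<exists>B\<in>\<B>. B \<inter> C = {})" for C
  have good: "card (C \<inter> U) \<le> m * card (boundary E H C)" if "C \<subseteq> H" "avoid C" for C
    using assms(2) that unfolding routable_def H_def avoid_def by blast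
  define tight where
    "tight C \<longleftrightarrow> C \<subseteq> H \<and> avoid C \<and> card (C \<inter> U) = m * card (boundary E H C)" for C
  have tight_boundary: "card (boundary E H C) < J" if "tight C" for C
  proof -
    have "card (C \<inter> U) \<le> card U" using fU by (intro card_mono) auto
    then have "m * card (boundary E H C) < m * J"
      using that assms(3) M_le unfolding tight_def by linarith
    then show ?thesis by simp
  qed
  \<comment> \<open>Uncrossing: one bramble element avoids both small boundaries and hence both
    \<open>C\<close> and \<open>D\<close>. So the cut condition also holds for their union and
    intersection, and submodularity makes it an equality.\<close>
  have tight_Un: "tight (C \<union> D)" if C: "tight C" and D: "tight D" for C D
  proof -
    have CD: "C \<subseteq> H" "D \<subseteq> H" "finite C" "finite D"
      using C D fH unfolding tight_def by (auto intro: finite_subset)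
    have fin_b: "finite (boundary E H C)" "finite (boundary E H D)"
      using CD boundary_subset finite_subset by metis+
    have "card (boundary E H C \<union> boundary E H D) \<le> 2 * J"
      using card_Un_le[of "boundary E H C" "boundary E H D"] tight_boundary[OF C] tight_boundary[OF D]
      by linarith
    then obtain B where B: "B \<in> \<B>" "B \<inter> (boundary E H C \<union> boundary E H D) = {}"
      using order fin_b unfolding order_exceeds_def by (meson finite_UnI)
    have B_side: "B \<inter> A = {}" if A: "avoid A" "B \<inter> boundary E H A = {}" for A
    proof -
      obtain B' where "B' \<in> \<B>" "B' \<inter> A = {}" using A(1) unfolding avoid_def by blast
      moreover have "B \<subseteq> H" "B' \<subseteq> H" using B(1) \<open>B' \<in> \<B>\<close> unfolding H_def by auto
      ultimately show ?thesis
        using B(1) bramble A(2) conn_misses_side[of E B H B' A] unfolding bramble_def by blast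
    qed
    have "B \<inter> (C \<union> D) = {}"
      using B_side[of C] B_side[of D] B(2) C D unfolding tight_def by blast
    then have "avoid (C \<union> D)" "avoid (C \<inter> D)" using B(1) unfolding avoid_def by blast+
    then have le: "card ((C \<union> D) \<inter> U) \<le> m * card (boundary E H (C \<union> D))"
      "card ((C \<inter> D) \<inter> U) \<le> m * card (boundary E H (C \<inter> D))"
      using good CD by (auto intro!: good)
    have "(C \<inter> U) \<union> (D \<inter> U) = (C \<union> D) \<inter> U" "(C \<inter> U) \<inter> (D \<inter> U) = (C \<inter> D) \<inter> U" by blast+
    then have "card ((C \<union> D) \<inter> U) + card ((C \<inter> D) \<inter> U) = card (C \<inter> U) + card (D \<inter> U)"
      using card_Un_Int[of "C \<inter> U" "D \<inter> U"] fU by simp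
    also have "\<dots> = m * (card (boundary E H C) + card (boundary E H D))"
      using C D unfolding tight_def by (simp add: algebra_simps)
    finally have "m * (card (boundary E H (C \<union> D)) + card (boundary E H (C \<inter> D)))
        \<le> card ((C \<union> D) \<inter> U) + card ((C \<inter> D) \<inter> U)"
      using boundary_submodular[OF CD(3,4), of E H] by simp
    then have "card ((C \<union> D) \<inter> U) = m * card (boundary E H (C \<union> D))"
      using le by (simp add: algebra_simps)
    then show ?thesis using CD \<open>avoid (C \<union> D)\<close> unfolding tight_def by blast
  qed
  have "\<exists>C0. tight C0 \<and> (\<forall>C. tight C \<longrightarrow> C \<subseteq> C0)"
  proof -
    have "tight {}"
      using order_exceeds_nonempty[OF order] unfolding tight_def avoid_def boundary_def by auto
    moreover have "\<forall>C. tight C \<longrightarrow> card C < Suc (card H)"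
      using fH unfolding tight_def by (simp add: card_mono less_Suc_eq_le)
    ultimately obtain C0 where C0: "tight C0" "\<And>C. tight C \<Longrightarrow> card C \<le> card C0"
      using ex_has_greatest_nat[of tight "{}" card] by blast
    have "C \<subseteq> C0" if "tight C" for C
    proof -
      have "finite (C \<union> C0)"
        using that C0(1) fH unfolding tight_def by (meson finite_UnI finite_subset)
      then have "C0 = C \<union> C0"
        using C0(2)[OF tight_Un[OF that C0(1)]] by (intro card_seteq) auto
      then show ?thesis by blast
    qed
    then show ?thesis using C0(1) by blast
  qed
  then obtain C0 where C0: "tight C0" and max: "\<And>C. tight C \<Longrightarrow> C \<subseteq> C0" by blast
  \<comment> \<open>A set \<open>C'\<close> that blocks the addition of \<open>x\<close> contains
    \<open>x\<close>. Adding \<open>x\<close> raises the demand by only one, so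
    \<open>C' \<inter> H\<close> was already tight, with the same boundary. Hence a vertex
    \<open>x\<close> outside \<open>H\<close> is not on the boundary of \<open>C'\<close>.\<close>
  have new: "(x \<in> H \<longrightarrow> x \<in> C0) \<and> (x \<notin> H \<longrightarrow> (\<forall>y\<in>H - C0. (x, y) \<notin> E))" if x: "x \<in> V - U" for x
  proof -
    define H' where "H' = insert x H"
    have H': "\<Union>\<B> \<union> insert x U = H'" unfolding H'_def H_def by blast
    obtain C' where C': "C' \<subseteq> H'" "avoid C'" "m * card (boundary E H' C') < card (C' \<inter> insert x U)"
      using bad[OF x] unfolding routable_def H' avoid_def by (meson not_le)
    define C where "C = C' \<inter> H"
    have CH: "C \<subseteq> H" and av: "avoid C" using C'(2) unfolding C_def avoid_def by blast+
    have fC': "finite C'" using C'(1) fH unfolding H'_def by (meson finite.insertI finite_subset)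
    have sub: "boundary E H C \<subseteq> boundary E H' C'" unfolding boundary_def C_def H'_def by blast
    have fb: "finite (boundary E H' C')" using fC' boundary_subset finite_subset by metis
    have mb: "m * card (boundary E H C) \<le> m * card (boundary E H' C')"
      using card_mono[OF fb sub] by simp
    have CU: "C' \<inter> U = C \<inter> U" unfolding C_def using UH by blast
    have xC': "x \<in> C'"
    proof (rule ccontr)
      assume "x \<notin> C'"
      then have "C' \<inter> insert x U = C \<inter> U" using CU by blast
      then have "card (C' \<inter> insert x U) = card (C \<inter> U)" by simp
      then show False using good[OF CH av] mb C'(3) by linarith
    qed
    then have "C' \<inter> insert x U = insert x (C \<inter> U)" using CU by blast
    then have "card (C' \<inter> insert x U) = Suc (card (C \<inter> U))" using x fU by simp
    then have eq: "card (C \<inter> U) = m * card (boundary E H C)"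
      "m * card (boundary E H C) = m * card (boundary E H' C')"
      using good[OF CH av] mb C'(3) by linarith+
    then have "C \<subseteq> C0" using max CH av unfolding tight_def by blast
    have "boundary E H C = boundary E H' C'"
      using card_seteq[OF fb sub] eq(2) m_pos by simp
    then have "x \<notin> H \<longrightarrow> x \<notin> boundary E H' C'" unfolding boundary_def C_def by blast
    then have "x \<notin> H \<longrightarrow> (\<forall>y\<in>H' - C'. (x, y) \<notin> E)" using xC' unfolding boundary_def by blast
    then show ?thesis using xC' \<open>C \<subseteq> C0\<close> unfolding C_def H'_def by blast
  qed
  \<comment> \<open>By \<open>new\<close>, the vertices outside \<open>H\<close> join the source
    side without changing the boundary, and everything in \<open>H - C0\<close> belongs to
    \<open>U\<close>. So \<open>capacity\<close> bounds \<open>M\<close> by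
    \<open>card U\<close>.\<close>
  define Cs where "Cs = C0 \<union> (V - H)"
  have C0H: "C0 \<subseteq> H" using C0 unfolding tight_def by blast
  have V_Cs: "V - Cs = H - C0" unfolding Cs_def using HV C0H by blast
  have b_Cs: "boundary E V Cs = boundary E H C0"
  proof
    show "boundary E V Cs \<subseteq> boundary E H C0"
      unfolding boundary_def V_Cs using new UH unfolding Cs_def by blast
    show "boundary E H C0 \<subseteq> boundary E V Cs"
      unfolding boundary_def V_Cs unfolding Cs_def by blast
  qed
  obtain B where B: "B \<in> \<B>" "B \<inter> C0 = {}" using C0 unfolding tight_def avoid_def by blast
  have "M \<le> card (V - Cs) + m * card (boundary E V Cs)"
  proof (rule capacity[OF _ B(1)])
    show "Cs \<subseteq> V" using HV C0H unfolding Cs_def by blast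
    show "B \<inter> Cs = {}" using B unfolding Cs_def H_def by blast
    show "card (boundary E V Cs) < J" unfolding b_Cs by (rule tight_boundary[OF C0])
  qed
  also have "\<dots> = card (H - C0) + card (C0 \<inter> U)"
    using C0 unfolding V_Cs b_Cs tight_def by simp
  also have "\<dots> \<le> card (U - C0) + card (U \<inter> C0)"
    using fU new HV by (intro add_mono card_mono) auto
  also have "\<dots> = card U" using card_Int_Diff[OF fU, of C0] by simp
  finally show False using assms(3) by simp
qed

lemma routable_exists: obtains U where "U \<subseteq> V" "card U = M" "routable U"
proof -
  have "n \<le> M \<Longrightarrow> \<exists>U\<subseteq>V. card U = n \<and> routable U" for n
  proof (induction n)
    case 0 show ?case by (intro exI[of _ "{}"]) (auto simp: routable_def)
  next
    case (Suc n)
    then obtain U where U: "U \<subseteq> V" "card U = n" "routable U" by auto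
    then obtain x where "x \<in> V - U" "routable (insert x U)" using routable_extend Suc.prems by (metis Suc_le_eq)
    moreover have "finite U" using U(1) finite_V finite_subset by blast
    ultimately show ?case using U by (intro exI[of _ "insert x U"]) auto
  qed
  then show thesis using that by blast
qed

end

text \<open>\<open>halve\<close> says, in terms of \<open>conn\<close>, that every induced subgraph
  has a balanced cutset of size at most \<open>s\<close>.\<close>

locale halving =
  fixes E :: "'a rel" and V :: "'a set" and s :: nat
  assumes finite_V: "finite V" and sym: "sym E" and s_pos: "1 \<le> s"
    and halve: "\<And>H. H \<subseteq> V \<Longrightarrow>
      \<exists>S\<subseteq>H. card S \<le> s \<and> (\<forall>D. conn E D \<longrightarrow> D \<subseteq> H - S \<longrightarrow> 2 * card D \<le> card H)"
begin

text \<open>The elements avoiding a halving set \<open>S\<close> have a connected union, which fills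
  at most half of \<open>\<Union>\<C>\<close>, while deleting \<open>S\<close> lowers the order by
  at most \<open>s\<close>.\<close>

lemma bramble_doubling:
  assumes "bramble E \<C>" "\<Union>\<C> \<subseteq> V" "order_exceeds \<C> (p + s)"
    and n: "\<And>\<D>. \<D> \<subseteq> \<C> \<Longrightarrow> order_exceeds \<D> p \<Longrightarrow> n \<le> card (\<Union>\<D>)"
  shows "2 * n \<le> card (\<Union>\<C>)"
proof -
  obtain S where S: "S \<subseteq> \<Union>\<C>" "card S \<le> s"
    "\<And>D. conn E D \<Longrightarrow> D \<subseteq> \<Union>\<C> - S \<Longrightarrow> 2 * card D \<le> card (\<Union>\<C>)"
    using halve[OF assms(2)] by blast
  let ?\<D> = "{B \<in> \<C>. B \<inter> S = {}}"
  have fS: "finite S" using S(1) assms(2) finite_V by (meson finite_subset)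
  have o: "order_exceeds ?\<D> p" by (rule order_exceeds_avoid[OF assms(3) fS S(2)])
  have "conn E (\<Union>?\<D>)"
    by (rule bramble_conn_Union[OF bramble_subset[OF assms(1)] order_exceeds_nonempty[OF o]]) blast
  then have "2 * card (\<Union>?\<D>) \<le> card (\<Union>\<C>)" by (rule S(3)) blast
  moreover have "n \<le> card (\<Union>?\<D>)" by (rule n[OF _ o]) blast
  ultimately show ?thesis by simp
qed

text \<open>The constants: \<open>8 * s\<close> is \<open>2 * J\<close> for separators below
  \<open>J = 4 * s\<close>; two doublings lead from there to \<open>10 * s\<close> and quadruple the
  union; the last \<open>4 * s\<close> pay for avoiding a small separator when
  \<open>capacity\<close> is checked.\<close>

theorem bramble_order_le:
  assumes "bramble E \<B>" "\<Union>\<B> \<subseteq> V"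
  shows "\<not> order_exceeds \<B> (14 * s)"
proof
  assume ord: "order_exceeds \<B> (14 * s)"
  have "\<B> \<subseteq> \<B> \<and> order_exceeds \<B> (8 * s)" using order_exceeds_mono[OF ord] by simp
  then obtain \<B>0 where B0: "\<B>0 \<subseteq> \<B>" "order_exceeds \<B>0 (8 * s)"
    and B0_min: "\<And>\<C>. \<C> \<subseteq> \<B> \<Longrightarrow> order_exceeds \<C> (8 * s) \<Longrightarrow> card (\<Union>\<B>0) \<le> card (\<Union>\<C>)"
    using exists_least_iff[of "\<lambda>n. \<exists>\<C>. \<C> \<subseteq> \<B> \<and> order_exceeds \<C> (8 * s) \<and> card (\<Union>\<C>) = n"]
    by (metis (no_types, lifting) not_le_imp_less)
  \<comment> \<open>The rounding in \<open>m\<close> gives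
    \<open>N \<le> m * s \<le> N + s\<close>.\<close>
  define A N m where "A = \<Union>\<B>0" and "N = card A" and "m = N div s + 1"
  have sub: "bramble E \<C>" "\<Union>\<C> \<subseteq> V" if "\<C> \<subseteq> \<B>" for \<C>
    using bramble_subset[OF assms(1) that] that assms(2) by blast+
  have AV: "A \<subseteq> V" using sub(2)[OF B0(1)] unfolding A_def .
  have fin: "finite X" if "X \<subseteq> V" for X using that finite_V by (rule finite_subset)
  have "8 * s < N"
    unfolding N_def A_def
  proof (rule order_exceeds_less_card_Union[OF B0(2)])
    show "B \<noteq> {}" if "B \<in> \<B>0" for B
      using that sub(1)[OF B0(1)] conn_nonempty unfolding bramble_def by blast
  qed (use fin AV A_def in blast)
  have N2: "2 * N \<le> card (\<Union>\<C>)" if "\<C> \<subseteq> \<B>" "order_exceeds \<C> (9 * s)" for \<C>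
    using bramble_doubling[OF sub[OF that(1)], of "8 * s" N] that B0_min
    unfolding N_def A_def by (simp add: algebra_simps)
  have N4: "4 * N \<le> card (\<Union>\<C>)" if "\<C> \<subseteq> \<B>" "order_exceeds \<C> (10 * s)" for \<C>
  proof -
    have "2 * (2 * N) \<le> card (\<Union>\<C>)"
    proof (rule bramble_doubling[OF sub[OF that(1)], of "9 * s"])
      show "order_exceeds \<C> (9 * s + s)" using that(2) by (simp add: algebra_simps)
      show "2 * N \<le> card (\<Union>\<D>)" if "\<D> \<subseteq> \<C>" "order_exceeds \<D> (9 * s)" for \<D>
        using N2 that \<open>\<C> \<subseteq> \<B>\<close> by blast
    qed
    then show ?thesis by simp
  qed
  have ms: "N \<le> m * s" "m * s \<le> N + s"
  proof -
    have "N div s * s + N mod s = N" "N mod s < s" using s_pos by simp_all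
    moreover have "m * s = N div s * s + s" unfolding m_def by (simp add: algebra_simps)
    ultimately show "N \<le> m * s" "m * s \<le> N + s" by linarith+
  qed
  interpret routing E V \<B>0 m "4 * s" "4 * N"
  proof
    show "bramble E \<B>0" "\<Union>\<B>0 \<subseteq> V" by (fact sub[OF B0(1)])+
    show "order_exceeds \<B>0 (2 * (4 * s))" using B0(2) by simp
    show "4 * N \<le> m * (4 * s)" using ms(1) by simp
    fix C B assume C: "C \<subseteq> V" "B \<in> \<B>0" "B \<inter> C = {}" "card (boundary E V C) < 4 * s"
    let ?S = "boundary E V C"
    \<comment> \<open>These elements all lie outside \<open>C\<close>, since \<open>B\<close> does.
      Their union has at least \<open>4 * N\<close> vertices, so the first summand of
      \<open>capacity\<close> suffices.\<close>
    let ?\<C> = "{B \<in> \<B>. B \<inter> ?S = {}}"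
    have fS: "finite ?S" using fin[OF C(1)] boundary_subset finite_subset by metis
    have "order_exceeds ?\<C> (10 * s)"
    proof (rule order_exceeds_avoid[OF _ fS])
      show "order_exceeds \<B> (10 * s + 4 * s)" using ord by simp
    qed (use C(4) in simp)
    then have "4 * N \<le> card (\<Union>?\<C>)" using N4[of ?\<C>] by blast
    also have "\<dots> \<le> card (V - C)"
    proof (rule card_mono)
      have "B' \<inter> C = {}" if "B' \<in> ?\<C>" for B'
      proof (rule conn_misses_side[of E B' V B])
        show "conn E B'" "touch E B' B"
          using that assms(1) C(2) B0(1) unfolding bramble_def by blast+
        show "B' \<subseteq> V" "B \<subseteq> V" using that C(2) B0(1) assms(2) by blast+
      qed (use that C(3) in auto)
      then show "\<Union>?\<C> \<subseteq> V - C" using assms(2) by blast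
    qed (use finite_V in simp)
    finally show "4 * N \<le> card (V - C) + m * card ?S" by simp
  qed (use finite_V m_def in auto)
  obtain U where U: "U \<subseteq> V" "card U = 4 * N" "routable U" by (rule routable_exists)
  define H where "H = A \<union> U"
  have HV: "H \<subseteq> V" using AV U(1) unfolding H_def by blast
  have cH: "card H \<le> 5 * N" using card_Un_le[of A U] U(2) unfolding H_def N_def by simp
  obtain S where S: "S \<subseteq> H" "card S \<le> s"
    "\<And>D. conn E D \<Longrightarrow> D \<subseteq> H - S \<Longrightarrow> 2 * card D \<le> card H"
    using halve[OF HV] by blast
  have fS: "finite S" using S(1) HV fin by blast
  have "card S \<le> 8 * s" using S(2) by simp
  then obtain B where B: "B \<in> \<B>0" "B \<inter> S = {}"
    using B0(2) fS unfolding order_exceeds_def by blast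
  have cB: "conn E B" using B(1) bramble unfolding bramble_def by blast
  then obtain v where v: "v \<in> B" using conn_nonempty by blast
  have BH: "B \<subseteq> H - S" using B unfolding H_def A_def by blast
  then have "v \<in> H - S" using v by blast
  then obtain D where D: "D \<subseteq> H - S" "conn E D"
    "\<And>x y. (x, y) \<in> E \<Longrightarrow> x \<in> D \<Longrightarrow> y \<in> H - S \<Longrightarrow> y \<in> D" "B \<subseteq> D"
    using component_exists[OF sym] cB BH v by metis
  \<comment> \<open>\<open>D\<close> is closed under adjacency in \<open>H - S\<close>, so
    \<open>S\<close> separates the source side \<open>H - D\<close> from the element
    \<open>B\<close> inside \<open>D\<close>.\<close>
  have "boundary E H (H - D) \<subseteq> S"
    using D(3) symD[OF sym] unfolding boundary_def by blast
  then have "card (boundary E H (H - D)) \<le> s"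
    using card_mono[OF fS] S(2) le_trans by blast
  then have "m * card (boundary E H (H - D)) \<le> m * s" by simp
  moreover have "card ((H - D) \<inter> U) \<le> m * card (boundary E H (H - D))"
    unfolding H_def A_def
  proof (rule routableD[OF U(3) _ B(1)])
    show "B \<inter> (\<Union>\<B>0 \<union> U - D) = {}" using D(4) by blast
  qed blast
  moreover have "card U \<le> card ((H - D) \<inter> U) + card D"
  proof -
    have "finite D" "finite ((H - D) \<inter> U)" using D(1) HV fin by blast+
    then have "card U \<le> card ((H - D) \<inter> U \<union> D)"
      by (intro card_mono) (auto simp: H_def)
    then show ?thesis using card_Un_le le_trans by blast
  qed
  moreover have "2 * card D \<le> card H" by (rule S(3)[OF D(2,1)])
  \<comment> \<open>From \<open>4 * N \<le> m * s + card D\<close>, where \<open>D\<close> has at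
    most half of the at most \<open>5 * N\<close> vertices of \<open>H\<close>. With
    \<open>m * s \<le> N + s\<close> this yields \<open>N \<le> 2 * s\<close>.\<close>
  ultimately have "3 * N \<le> 2 * (m * s)" using U(2) cH by linarith
  then show False using ms(2) \<open>8 * s < N\<close> by linarith
qed

end

section \<open>Connectivity and trees in digraphs\<close>

text \<open>The set of vertices reachable from \<open>x\<close> inside \<open>S\<close> has no exit
  in \<open>S\<close>; conversely, a walk from inside \<open>A\<close> to outside \<open>A\<close>
  contains an exit.\<close>

lemma conn_iff_rtrancl_on:
  "conn E S \<longleftrightarrow> S \<noteq> {} \<and> (\<forall>x\<in>S. \<forall>y\<in>S. (x, y) \<in> rtrancl_on S E)"
proof (intro iffI conjI ballI)
  assume c: "conn E S"
  then show "S \<noteq> {}" by (rule conn_nonempty)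
  fix x y assume x: "x \<in> S" and y: "y \<in> S"
  show "(x, y) \<in> rtrancl_on S E"
  proof (rule ccontr)
    assume "(x, y) \<notin> rtrancl_on S E"
    then have "x \<in> {z. (x, z) \<in> rtrancl_on S E}" "y \<notin> {z. (x, z) \<in> rtrancl_on S E}"
      using x by simp_all
    then obtain u v where "u \<in> {z. (x, z) \<in> rtrancl_on S E}" "v \<in> S"
      "v \<notin> {z. (x, z) \<in> rtrancl_on S E}" "(u, v) \<in> E"
      by (rule conn_exitE[OF c x _ y])
    then show False by (auto intro: rtrancl_on_into_rtrancl_on)
  qed
next
  assume r: "S \<noteq> {} \<and> (\<forall>x\<in>S. \<forall>y\<in>S. (x, y) \<in> rtrancl_on S E)"
  show "conn E S"
  proof (rule connI_exit)
    fix A x y assume xy: "x \<in> S" "x \<in> A" "y \<in> S" "y \<notin> A"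
    then have "(x, y) \<in> rtrancl_on S E" using r by blast
    then show "\<exists>u v. u \<in> S \<and> u \<in> A \<and> v \<in> S \<and> v \<notin> A \<and> (u, v) \<in> E"
      using xy(4)
    proof (induction rule: rtrancl_on_induct)
      case base then show ?case using xy(2) by blast
    next
      case (step v w) then show ?case by (cases "v \<in> A") auto
    qed
  qed (use r in blast)
qed

lemma conn_restrict:
  assumes "S \<subseteq> H"
  shows "conn (E \<inter> H \<times> H) S \<longleftrightarrow> conn E S"
proof -
  have "(\<exists>u\<in>A. \<exists>v\<in>S - A. (u, v) \<in> E \<inter> H \<times> H) \<longleftrightarrow> (\<exists>u\<in>A. \<exists>v\<in>S - A. (u, v) \<in> E)" if "A \<subseteq> S" for A
    using that assms by blast
  then show ?thesis unfolding conn_def by meson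
qed

lemma conn_mono: "conn E S \<Longrightarrow> E \<subseteq> F \<Longrightarrow> conn F S"
  unfolding conn_def by (meson subset_eq)

lemma arcs_ends_induce: "arcs_ends (with_proj T \<restriction> S) = parcs T \<inter> S \<times> S"
  by (auto simp: arcs_ends_conv)

lemma symcl_sym: "sym R \<Longrightarrow> R\<^sup>s = R"
  by (auto simp: symcl_def dest: symD)

lemma connected_induce_iff:
  assumes "sym (parcs T)"
  shows "connected (with_proj T \<restriction> S) \<longleftrightarrow> conn (parcs T) S"
proof -
  have "sym (parcs T \<inter> S \<times> S)" using assms by (auto simp: sym_def)
  then have "connected (with_proj T \<restriction> S) \<longleftrightarrow> conn (parcs T \<inter> S \<times> S) S"
    unfolding connected_conv conn_iff_rtrancl_on arcs_ends_induce by (simp add: symcl_sym)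
  then show ?thesis by (simp add: conn_restrict)
qed

lemma connected_iff:
  assumes "sym (parcs T)"
  shows "connected (with_proj T) \<longleftrightarrow> conn (parcs T) (pverts T)"
  unfolding connected_conv conn_iff_rtrancl_on using symcl_sym[OF assms] by simp

lemma (in pair_sym_digraph) sym_parcs: "sym (parcs G)"
  by (rule symI) (rule arcs_symmetric)

text \<open>All connected sets may replace the components: each connected set lies in one component,
  and components are connected themselves.\<close>

lemma balanced_cutset_iff:
  assumes "pair_graph \<Gamma>"
  shows "balanced_cutset \<Gamma> S \<longleftrightarrow> S \<subseteq> pverts \<Gamma> \<and>
    (\<forall>D. conn (parcs \<Gamma>) D \<longrightarrow> D \<subseteq> pverts \<Gamma> - S \<longrightarrow> 2 * card D \<le> card (pverts \<Gamma>))"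
proof -
  interpret pair_graph \<Gamma> by fact
  let ?V = "pverts \<Gamma>"
  let ?G = "with_proj \<Gamma> \<restriction> (?V - S)"
  interpret G': wf_digraph ?G by (rule wellformed_induce_subgraph)
  have half: "real a \<le> 1 / 2 * real b \<longleftrightarrow> 2 * a \<le> b" for a b :: nat by linarith
  have "(\<forall>C\<in>pre_digraph.sccs ?G. 2 * card (verts C) \<le> card ?V) \<longleftrightarrow>
    (\<forall>D. conn (parcs \<Gamma>) D \<longrightarrow> D \<subseteq> ?V - S \<longrightarrow> 2 * card D \<le> card ?V)"
  proof (intro iffI allI impI ballI)
    fix D assume sccs: "\<forall>C\<in>pre_digraph.sccs ?G. 2 * card (verts C) \<le> card ?V"
      and D: "conn (parcs \<Gamma>) D" "D \<subseteq> ?V - S"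
    obtain v where v: "v \<in> D" using conn_nonempty[OF D(1)] by blast
    have "G'.scc_of v \<in> verts ` G'.sccs"
      using G'.scc_of_in_sccs_verts[of v] v D(2) by (auto simp: G'.sccs_verts_conv)
    then obtain C where C: "C \<in> G'.sccs" "verts C = G'.scc_of v" by auto
    have "(x, y) \<in> rtrancl_on (?V - S) (arcs_ends ?G)" if "x \<in> D" "y \<in> D" for x y
    proof -
      have "(x, y) \<in> rtrancl_on D (parcs \<Gamma> \<inter> (?V - S) \<times> (?V - S))"
        using D that conn_restrict[OF D(2), of "parcs \<Gamma>"] unfolding conn_iff_rtrancl_on by blast
      then show ?thesis
        unfolding arcs_ends_induce by (rule rtrancl_on_mono[OF subset_refl D(2)])
    qed
    then have "D \<subseteq> G'.scc_of v" using v unfolding G'.scc_of_def reachable_def by auto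
    moreover have "finite (verts C)"
    proof -
      have "verts C \<subseteq> ?V" using C(2) G'.sccs_verts_subsets[OF G'.scc_of_in_sccs_verts] v D(2) by auto
      then show ?thesis by (rule finite_subset) (rule pair_finite_verts)
    qed
    ultimately have "card D \<le> card (verts C)" using C(2) by (metis card_mono)
    then show "2 * card D \<le> card ?V" using sccs C(1) by fastforce
  next
    fix C assume all: "\<forall>D. conn (parcs \<Gamma>) D \<longrightarrow> D \<subseteq> ?V - S \<longrightarrow> 2 * card D \<le> card ?V"
      and C: "C \<in> pre_digraph.sccs ?G"
    have ind: "induced_subgraph C ?G" and sc: "strongly_connected C"
      using C by (auto elim: G'.in_sccsE)
    have sub: "subgraph C ?G" using ind by (rule induced_imp_subgraph)
    have "arcs_ends C \<subseteq> parcs \<Gamma>"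
      using arcs_ends_mono[OF sub] unfolding arcs_ends_induce by blast
    moreover have "conn (arcs_ends C) (verts C)"
      using sc unfolding strongly_connected_def reachable_def conn_iff_rtrancl_on by blast
    ultimately have "conn (parcs \<Gamma>) (verts C)" by (rule conn_mono[rotated])
    moreover have "verts C \<subseteq> ?V - S" using subgraph_imp_subverts[OF sub] by simp
    ultimately show "2 * card (verts C) \<le> card ?V" using all by blast
  qed
  then show ?thesis unfolding balanced_cutset_def half by blast
qed

section \<open>Cycles and leaves of undirected trees\<close>

lemma pcas_nth:
  "pcas u p v \<Longrightarrow> Suc i < length p \<Longrightarrow> fst (p ! Suc i) = snd (p ! i)"
proof (induction p arbitrary: u i)
  case (Cons e p)
  then show ?case by (cases i; cases p) auto
qed simp

lemma pcas_last: "pcas u p v \<Longrightarrow> p \<noteq> [] \<Longrightarrow> fst (hd p) = u \<and> snd (last p) = v"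
  by (induction p arbitrary: u) auto

text \<open>Reading the arcs cyclically, modulo the length, removes the special role of the start of
  the walk.\<close>

lemma pair_cycleD:
  assumes "pre_digraph.cycle (with_proj T) p"
  shows "set p \<subseteq> parcs T" "distinct (map snd p)"
    and "i < length p \<Longrightarrow> fst (p ! (Suc i mod length p)) = snd (p ! i)"
proof -
  obtain u where u: "pre_digraph.awalk (with_proj T) u p u"
    "distinct (tl (pre_digraph.awalk_verts (with_proj T) u p))" "p \<noteq> []"
    using assms unfolding pre_digraph.cycle_def by blast
  have c: "pre_digraph.cas (with_proj T) u p u" and "set p \<subseteq> parcs T"
    using u(1) unfolding pre_digraph.awalk_def by auto
  then show "set p \<subseteq> parcs T" by simp
  have "tl (pre_digraph.awalk_verts (with_proj T) u p) = map snd p"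
    using pre_digraph.awalk_verts_conv'[OF c] u(3) by simp
  then show "distinct (map snd p)" using u(2) by simp
  assume i: "i < length p"
  have pc: "pcas u p u" using c by (simp add: cas_with_proj_eq)
  show "fst (p ! (Suc i mod length p)) = snd (p ! i)"
  proof (cases "Suc i < length p")
    case True then show ?thesis using pcas_nth[OF pc] by simp
  next
    case False
    then have "Suc i = length p" using i by simp
    then have "p ! i = last p" using u(3) by (metis diff_Suc_1 last_conv_nth)
    then show ?thesis using pcas_last[OF pc u(3)] \<open>Suc i = length p\<close> u(3) by (simp add: hd_conv_nth)
  qed
qed

definition add_leaf :: "'t pair_pre_digraph \<Rightarrow> 't \<Rightarrow> 't \<Rightarrow> 't pair_pre_digraph" where
  "add_leaf T g h = \<lparr>pverts = insert h (pverts T), parcs = parcs T \<union> {(g, h), (h, g)}\<rparr>"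

lemma add_leaf_simps[simp]:
  "pverts (add_leaf T g h) = insert h (pverts T)"
  "parcs (add_leaf T g h) = parcs T \<union> {(g, h), (h, g)}"
  by (simp_all add: add_leaf_def)

text \<open>A cycle entering the leaf \<open>h\<close> comes from \<open>g\<close> and returns to
  \<open>g\<close>, so the arcs just before and just after the entering arc both end in
  \<open>g\<close>. For length at least 3 these are different arcs, but the heads along a cycle are
  distinct.\<close>

lemma cycle_add_leaf:
  assumes "pair_wf_digraph T" "g \<in> pverts T" "h \<notin> pverts T"
    and cyc: "pre_digraph.cycle (with_proj (add_leaf T g h)) p" and len: "3 \<le> length p"
  shows "pre_digraph.cycle (with_proj T) p"
proof -
  interpret pair_wf_digraph T by fact
  let ?n = "length p"
  note c = pair_cycleD[OF cyc]
  have old: "snd e \<noteq> h \<and> fst e \<noteq> h" if "e \<in> parcs T" for e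
    using that assms(3) arc_fst_in_verts arc_snd_in_verts by metis
  have new: "snd e = h \<Longrightarrow> fst e = g" "fst e = h \<Longrightarrow> snd e = g" if "e \<in> parcs (add_leaf T g h)" for e
    using that old[of e] assms(2,3) by (cases e; auto)+
  have snd_h: "snd (p ! i) \<noteq> h" if i: "i < ?n" for i
  proof
    assume ih: "snd (p ! i) = h"
    let ?j = "Suc i mod ?n"
    define k where "k = (if i = 0 then ?n - 1 else i - 1)"
    have "0 < ?n" using len by linarith
    then have j: "?j < ?n" by (rule mod_less_divisor)
    have k: "k < ?n" "Suc k mod ?n = i"
      using len i unfolding k_def by auto
    have "p ! i \<in> parcs (add_leaf T g h)" "p ! ?j \<in> parcs (add_leaf T g h)"
      using c(1) i j by (meson nth_mem subset_eq)+
    then have "fst (p ! i) = g" "snd (p ! ?j) = g"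
      using ih c(3)[OF i] new[of "p ! i"] new[of "p ! ?j"] by simp_all
    then have "snd (p ! k) = snd (p ! ?j)" using c(3)[OF k(1)] k(2) by simp
    then have "k = ?j"
      using c(2) j k(1) by (simp add: distinct_conv_nth) (metis)
    then show False using len i unfolding k_def by (auto simp: mod_Suc split: if_splits)
  qed
  have fst_h: "fst (p ! i) \<noteq> h" if i: "i < ?n" for i
  proof -
    define k where "k = (if i = 0 then ?n - 1 else i - 1)"
    have k: "k < ?n" "Suc k mod ?n = i" using len i unfolding k_def by auto
    show ?thesis using c(3)[OF k(1)] k(2) snd_h[OF k(1)] by simp
  qed
  have sub: "set p \<subseteq> parcs T"
  proof
    fix e assume e: "e \<in> set p"
    then obtain i where "i < ?n" "p ! i = e" unfolding in_set_conv_nth by blast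
    then have "snd e \<noteq> h" "fst e \<noteq> h" using snd_h fst_h by blast+
    moreover have "e \<in> parcs (add_leaf T g h)" using c(1) e by blast
    ultimately show "e \<in> parcs T" by auto
  qed
  obtain u where u: "pre_digraph.awalk (with_proj (add_leaf T g h)) u p u"
    "distinct (tl (pre_digraph.awalk_verts (with_proj (add_leaf T g h)) u p))" "p \<noteq> []"
    using cyc unfolding pre_digraph.cycle_def by blast
  have pc: "pcas u p u" using u(1) unfolding pre_digraph.awalk_def by (simp add: cas_with_proj_eq)
  have "u \<in> pverts T"
    using pcas_last[OF pc u(3)] sub u(3) arc_fst_in_verts hd_in_set by (metis subset_eq)
  then show ?thesis
    using u(2,3) pc sub unfolding pre_digraph.cycle_def pre_digraph.awalk_def
    by (auto simp: cas_with_proj_eq awalk_verts_with_proj_eq intro!: exI[of _ u])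
qed

lemma undirected_tree_bidirected: "undirected_tree T \<Longrightarrow> pair_bidirected_digraph T"
  by (simp add: undirected_tree_def)

lemma undirected_tree_sym: "undirected_tree T \<Longrightarrow> sym (parcs T)"
  unfolding undirected_tree_def pair_bidirected_digraph_def
  by (meson pair_sym_digraph.sym_parcs)

lemma undirected_tree_conn: "undirected_tree T \<Longrightarrow> conn (parcs T) (pverts T)"
  using connected_iff undirected_tree_sym undirected_tree_def by blast

lemma undirected_tree_singleton: "undirected_tree \<lparr>pverts = {g}, parcs = {}\<rparr>"
  unfolding undirected_tree_def
proof (intro conjI)
  show "pair_bidirected_digraph \<lparr>pverts = {g}, parcs = {}\<rparr>"
    by unfold_locales (auto simp: symmetric_def sym_def)
  show "connected (with_proj \<lparr>pverts = {g}, parcs = {}\<rparr>)"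
    by (subst connected_iff) (auto simp: sym_def conn_singleton)
  show "\<nexists>p. pre_digraph.cycle (with_proj \<lparr>pverts = {g}, parcs = {}\<rparr>) p \<and> 3 \<le> length p"
    using pair_cycleD(1) by fastforce
qed

lemma undirected_tree_add_leaf:
  assumes T: "undirected_tree T" and gh: "g \<in> pverts T" "h \<notin> pverts T"
  shows "undirected_tree (add_leaf T g h)"
proof -
  interpret pair_bidirected_digraph T by (rule undirected_tree_bidirected[OF T])
  have s: "sym (parcs (add_leaf T g h))"
    using arcs_symmetric by (auto intro!: symI)
  have "pair_bidirected_digraph (add_leaf T g h)"
  proof
    show "symmetric (with_proj (add_leaf T g h))" using s by (simp add: symmetric_def)
  next
    fix e assume "e \<in> parcs (add_leaf T g h)"
    then have "e \<in> parcs T \<or> e = (g, h) \<or> e = (h, g)" by auto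
    then show "fst e \<in> pverts (add_leaf T g h)" "snd e \<in> pverts (add_leaf T g h)" "fst e \<noteq> snd e"
      using gh arc_fst_in_verts[of e] arc_snd_in_verts[of e] pair_no_loops[of e] by auto
  qed
  moreover have "conn (parcs (add_leaf T g h)) (pverts (add_leaf T g h))"
    unfolding add_leaf_simps(1)
  proof (rule conn_insert_adjacent[OF s _ gh(1)])
    show "conn (parcs (add_leaf T g h)) (pverts T)"
      using undirected_tree_conn[OF T] by (rule conn_mono) auto
  qed simp
  ultimately show ?thesis
    using T cycle_add_leaf[OF _ gh] pair_wf_digraph_axioms
    unfolding undirected_tree_def connected_iff[OF s] by blast
qed

section \<open>Treewidth and cutsize\<close>

text \<open>The running intersection property: bags are added one by one as leaves, each meeting the
  earlier ones only within a single bag. Edges can be forgotten because \<open>tdec_edge\<close>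
  already places them in bags.\<close>

inductive grown :: "'a set \<Rightarrow> 'a set set \<Rightarrow> bool" for R where
  root: "grown R {R}"
| leaf: "grown R \<S> \<Longrightarrow> X \<in> \<S> \<Longrightarrow> Z \<inter> \<Union>\<S> \<subseteq> X \<Longrightarrow> grown R (insert Z \<S>)"

lemma grown_root: "grown R \<S> \<Longrightarrow> R \<in> \<S>"
  by (induction rule: grown.induct) auto

text \<open>The construction of \<open>\<T>\<close> is replayed after that of \<open>\<S>\<close>,
  starting by attaching \<open>Z\<close> to \<open>Y\<close>. Later bags meet
  \<open>\<Union>\<S>\<close> only inside \<open>Z\<close>, hence nowhere new.\<close>

lemma grown_Un:
  assumes "grown Z \<T>" "grown Y \<S>" "\<Union>\<S> \<inter> \<Union>\<T> \<subseteq> Y \<inter> Z"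
  shows "grown Y (\<S> \<union> \<T>)"
  using assms
proof (induction rule: grown.induct)
  case root
  have "grown Y (insert Z \<S>)"
    using root by (intro grown.leaf[OF root(1) grown_root[OF root(1)]]) auto
  then show ?case by simp
next
  case (leaf \<T> X W)
  have IH: "grown Y (\<S> \<union> \<T>)" using leaf by auto
  have "W \<inter> \<Union>\<S> \<subseteq> Z" "Z \<subseteq> \<Union>\<T>" using leaf.prems(2) grown_root[OF leaf.hyps(1)] by auto
  then have "W \<inter> \<Union>(\<S> \<union> \<T>) \<subseteq> X" using leaf.hyps(3) unfolding Union_Un_distrib by auto
  then have "grown Y (insert W (\<S> \<union> \<T>))" using grown.leaf[OF IH] leaf.hyps(2) by blast
  then show ?case by simp
qed

lemma tdec_grown: "tdec E Y \<S> \<Longrightarrow> grown Y \<S>"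
proof (induction rule: tdec.induct)
  case (leaf Y) show ?case by (rule grown.root)
next
  case (join Y \<S> Z \<T>) then show ?case by (intro grown_Un)
qed

text \<open>Each new bag becomes a fresh leaf \<open>h\<close> next to a node \<open>g\<close> with
  bag \<open>X\<close>. A vertex of the new bag that occurred before lies in \<open>X\<close>, so
  its set of nodes gains a neighbour of \<open>g\<close> and stays connected.\<close>

lemma grown_tree:
  assumes "grown R \<S>"
  shows "\<exists>(T :: nat pair_pre_digraph) B. undirected_tree T \<and> finite (pverts T) \<and> B ` pverts T = \<S> \<and>
    (\<forall>v\<in>\<Union>\<S>. conn (parcs T) {g \<in> pverts T. v \<in> B g})"
  using assms
proof (induction rule: grown.induct)
  case root
  have "{g. g = (0::nat) \<and> v \<in> R} = {0}" if "v \<in> R" for v using that by auto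
  then show ?case
    using undirected_tree_singleton[of "0::nat"]
    by (intro exI[of _ "\<lparr>pverts = {0::nat}, parcs = {}\<rparr>"] exI[of _ "\<lambda>_. R"]) (auto simp: conn_singleton)
next
  case (leaf \<S> X Z)
  obtain T :: "nat pair_pre_digraph" and B where T: "undirected_tree T" "finite (pverts T)"
    "B ` pverts T = \<S>" "\<forall>v\<in>\<Union>\<S>. conn (parcs T) {g \<in> pverts T. v \<in> B g}"
    using leaf.IH by (elim exE conjE)
  obtain g where g: "g \<in> pverts T" "B g = X" using T(3) leaf.hyps(2) by blast
  obtain h where h: "h \<notin> pverts T" using ex_new_if_finite[OF infinite_UNIV_nat T(2)] by blast
  let ?T = "add_leaf T g h" and ?B = "B(h := Z)"
  have tree: "undirected_tree ?T" by (rule undirected_tree_add_leaf[OF T(1) g(1) h])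
  have im: "?B ` pverts ?T = insert Z \<S>" using T(3) h by auto
  have "conn (parcs ?T) {k \<in> pverts ?T. v \<in> ?B k}" if v: "v \<in> \<Union>(insert Z \<S>)" for v
  proof -
    let ?N = "{k \<in> pverts T. v \<in> B k}"
    have N: "{k \<in> pverts ?T. v \<in> ?B k} = (if v \<in> Z then insert h ?N else ?N)"
      using h by auto
    show ?thesis
    proof (cases "v \<in> \<Union>\<S>")
      case True
      have c: "conn (parcs ?T) ?N" by (rule conn_mono[OF bspec[OF T(4) True]]) auto
      show ?thesis
      proof (cases "v \<in> Z")
        case True
        then have "g \<in> ?N" using \<open>v \<in> \<Union>\<S>\<close> leaf.hyps(3) g by blast
        then have "conn (parcs ?T) (insert h ?N)"
          by (rule conn_insert_adjacent[OF undirected_tree_sym[OF tree] c]) simp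
        then show ?thesis unfolding N using True by simp
      next
        case False then show ?thesis unfolding N using c by simp
      qed
    next
      case False
      then have empty: "?N = {}" using T(3) by blast
      have "v \<in> Z" using v False by simp
      then show ?thesis unfolding N empty by (simp add: conn_singleton)
    qed
  qed
  then show ?case using tree im T(2)
    by (intro exI[of _ ?T] exI[of _ ?B]) simp
qed

lemma tree_decomposition_if_tdec:
  assumes "tdec (parcs \<Gamma>) Y \<T>" "\<Union>\<T> = pverts \<Gamma>" "pair_graph \<Gamma>"
  obtains T :: "nat pair_pre_digraph" and B
  where "tree_decomposition \<Gamma> T B" "B ` pverts T = \<T>"
proof -
  interpret pair_graph \<Gamma> by fact
  obtain T :: "nat pair_pre_digraph" and B where T: "undirected_tree T" "B ` pverts T = \<T>"
    "\<And>v. v \<in> \<Union>\<T> \<Longrightarrow> conn (parcs T) {g \<in> pverts T. v \<in> B g}"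
    using grown_tree[OF tdec_grown[OF assms(1)]] by blast
  have "\<exists>g\<in>pverts T. v \<in> B g \<and> w \<in> B g" if e: "(v, w) \<in> parcs \<Gamma>" for v w
    using tdec_edge[OF assms(1) sym_parcs e] in_arcsD1[OF e] in_arcsD2[OF e] assms(2) T(2) by auto
  then have "tree_decomposition \<Gamma> T B"
    using T assms(2) unfolding tree_decomposition_def connected_induce_iff[OF undirected_tree_sym[OF T(1)]]
    by auto
  then show thesis using that T(2) by blast
qed

text \<open>\<open>int\<close> is not well-ordered, so \<open>LEAST\<close> needs a lower bound;
  shifting by \<open>b\<close> reduces it to \<open>nat\<close>.\<close>

lemma int_Least_bounded_below:
  fixes P :: "int \<Rightarrow> bool"
  assumes "P a" "\<And>k. P k \<Longrightarrow> b \<le> k"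
  shows "P (LEAST k. P k)" "P k \<Longrightarrow> (LEAST k. P k) \<le> k"
proof -
  define n where "n = (LEAST n. P (b + int n))"
  have n: "P (b + int n)"
    unfolding n_def by (rule LeastI[of _ "nat (a - b)"]) (use assms in simp)
  have min: "b + int n \<le> k" if "P k" for k
  proof -
    have "P (b + int (nat (k - b)))" using that assms(2)[OF that] by simp
    then have "n \<le> nat (k - b)" unfolding n_def by (rule Least_le)
    then show ?thesis using assms(2)[OF that] by linarith
  qed
  have "(LEAST k. P k) = b + int n" using n min by (rule Least_equality)
  then show "P (LEAST k. P k)" "P k \<Longrightarrow> (LEAST k. P k) \<le> k" using n min by simp_all
qed

section \<open>Attained values and first bounds of treewidth and cutsize\<close>

context
  fixes \<Gamma> :: "'a pair_pre_digraph"
  assumes graph: "pair_graph \<Gamma>"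
begin

interpretation pair_graph \<Gamma> by (rule graph)

lemma finite_bag_cards:
  assumes "tree_decomposition \<Gamma> T B"
  shows "finite ((\<lambda>g. int (card (B g))) ` pverts T)" "pverts T \<noteq> {}"
proof -
  have "card (B g) \<le> card (pverts \<Gamma>)" if "g \<in> pverts T" for g
    using assms that unfolding tree_decomposition_def by (intro card_mono[OF pair_finite_verts]) simp
  then have "(\<lambda>g. int (card (B g))) ` pverts T \<subseteq> {0..int (card (pverts \<Gamma>))}" by auto
  then show "finite ((\<lambda>g. int (card (B g))) ` pverts T)" by (rule finite_subset) simp
  have "undirected_tree T" using assms by (simp add: tree_decomposition_def)
  then show "pverts T \<noteq> {}" by (rule conn_nonempty[OF undirected_tree_conn])
qed

lemma card_bag_le_width:
  assumes "tree_decomposition \<Gamma> T B" "g \<in> pverts T"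
  shows "int (card (B g)) \<le> decomposition_width T B + 1"
  unfolding decomposition_width_def using finite_bag_cards[OF assms(1)] assms(2) by simp

lemma width_le:
  assumes "tree_decomposition \<Gamma> T B" "\<And>g. g \<in> pverts T \<Longrightarrow> int (card (B g)) \<le> k + 1"
  shows "decomposition_width T B \<le> k"
proof -
  have "Max ((\<lambda>g. int (card (B g))) ` pverts T) \<le> k + 1"
    using finite_bag_cards[OF assms(1)] assms(2) by (intro Max.boundedI) auto
  then show ?thesis unfolding decomposition_width_def by simp
qed

lemma width_ge:
  assumes "tree_decomposition \<Gamma> T B"
  shows "- 1 \<le> decomposition_width T B"
proof -
  obtain g where "g \<in> pverts T" using finite_bag_cards(2)[OF assms] by blast
  from card_bag_le_width[OF assms this] show ?thesis by linarith
qed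

lemma trivial_decomposition:
  obtains T :: "nat pair_pre_digraph" and B
  where "tree_decomposition \<Gamma> T B" "decomposition_width T B \<le> int (card (pverts \<Gamma>)) - 1"
proof -
  obtain T :: "nat pair_pre_digraph" and B
    where T: "tree_decomposition \<Gamma> T B" "B ` pverts T = {pverts \<Gamma>}"
    using tree_decomposition_if_tdec[OF tdec.leaf _ graph] by (metis cSup_singleton)
  have "decomposition_width T B \<le> int (card (pverts \<Gamma>)) - 1"
  proof (rule width_le[OF T(1)])
    fix g assume "g \<in> pverts T"
    then have "B g \<in> B ` pverts T" by (rule imageI)
    then show "int (card (B g)) \<le> int (card (pverts \<Gamma>)) - 1 + 1" unfolding T(2) by simp
  qed
  then show thesis using that T(1) by blast
qed

lemma treewidth_attained:
  obtains T :: "nat pair_pre_digraph" and B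
  where "tree_decomposition \<Gamma> T B" "decomposition_width T B = treewidth \<Gamma>"
    "\<And>(T' :: nat pair_pre_digraph) B'. tree_decomposition \<Gamma> T' B' \<Longrightarrow> treewidth \<Gamma> \<le> decomposition_width T' B'"
proof -
  let ?P = "\<lambda>k. \<exists>(T :: nat pair_pre_digraph) B. tree_decomposition \<Gamma> T B \<and> decomposition_width T B = k"
  obtain T0 :: "nat pair_pre_digraph" and B0 where "tree_decomposition \<Gamma> T0 B0"
    using trivial_decomposition .
  then have ex: "?P (decomposition_width T0 B0)" by blast
  have bound: "- 1 \<le> k" if "?P k" for k
  proof -
    obtain T :: "nat pair_pre_digraph" and B where "tree_decomposition \<Gamma> T B" "decomposition_width T B = k"
      using \<open>?P k\<close> by (elim exE conjE)
    then show ?thesis using width_ge by metis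
  qed
  have "?P (treewidth \<Gamma>)"
    unfolding treewidth_def by (rule int_Least_bounded_below(1)[of ?P, OF ex bound])
  then obtain T :: "nat pair_pre_digraph" and B
    where T: "tree_decomposition \<Gamma> T B" "decomposition_width T B = treewidth \<Gamma>"
    by (elim exE conjE)
  show thesis
  proof (rule that[OF T])
    fix T' :: "nat pair_pre_digraph" and B' assume "tree_decomposition \<Gamma> T' B'"
    then have P: "?P (decomposition_width T' B')" by blast
    show "treewidth \<Gamma> \<le> decomposition_width T' B'"
      unfolding treewidth_def by (rule int_Least_bounded_below(2)[of ?P, OF ex bound P])
  qed
qed

lemma treewidth_le_width:
  fixes T :: "nat pair_pre_digraph"
  assumes "tree_decomposition \<Gamma> T B"
  shows "treewidth \<Gamma> \<le> decomposition_width T B"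
  using treewidth_attained assms by metis

lemma treewidth_bounds: "- 1 \<le> treewidth \<Gamma>" "treewidth \<Gamma> \<le> int (card (pverts \<Gamma>)) - 1"
proof -
  show "- 1 \<le> treewidth \<Gamma>" using treewidth_attained width_ge by metis
  show "treewidth \<Gamma> \<le> int (card (pverts \<Gamma>)) - 1"
    using trivial_decomposition treewidth_le_width order_trans by metis
qed

lemma cutsize_attained:
  obtains S where "balanced_cutset \<Gamma> S" "card S = cutsize \<Gamma>"
proof -
  let ?P = "\<lambda>k. \<exists>S. balanced_cutset \<Gamma> S \<and> card S = k"
  have "balanced_cutset \<Gamma> (pverts \<Gamma>)"
    unfolding balanced_cutset_iff[OF graph] using conn_nonempty by fastforce
  then have "?P (card (pverts \<Gamma>))" by blast
  then have "?P (cutsize \<Gamma>)" unfolding cutsize_def by (rule LeastI)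
  then show thesis using that by blast
qed

lemma cutsize_le: "balanced_cutset \<Gamma> S \<Longrightarrow> cutsize \<Gamma> \<le> card S"
  unfolding cutsize_def by (rule Least_le) blast

lemma cutsize_le_card: "cutsize \<Gamma> \<le> card (pverts \<Gamma>)"
  using cutsize_attained pair_finite_verts by (metis balanced_cutset_def card_mono)

end

section \<open>Balanced bags and the main theorem\<close>

definition away :: "'t rel \<Rightarrow> 't \<Rightarrow> 't rel" where
  "away R t = {(x, y) \<in> R. x \<noteq> t \<and> y \<noteq> t}"

lemma sym_away: "sym R \<Longrightarrow> sym (away R t)"
  unfolding away_def by (auto intro!: symI dest: symD)

lemma rtrancl_on_away:
  assumes "(x, y) \<in> rtrancl_on N R" "t \<notin> N"
  shows "(x, y) \<in> (away R t)\<^sup>*"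
  using assms(1)
proof (induction rule: rtrancl_on_induct)
  case base show ?case by simp
next
  case (step y z)
  have "(y, z) \<in> away R t" using step assms(2) unfolding away_def by auto
  with step.IH show ?case by (rule rtrancl_into_rtrancl)
qed

text \<open>Cut the walk at its last visit to \<open>t\<close>; \<open>h\<close> is the next
  node.\<close>

lemma last_departure:
  assumes "(t, x) \<in> rtrancl_on N R"
  shows "x = t \<or> (\<exists>h\<in>N. (t, h) \<in> R \<and> (h, x) \<in> (away R t)\<^sup>*)"
  using assms
proof (induction rule: rtrancl_on_induct)
  case base show ?case by simp
next
  case (step y z)
  show ?case
  proof (cases "z = t \<or> y = t")
    case True then show ?thesis using step.hyps by blast
  next
    case False
    then obtain h where h: "h \<in> N" "(t, h) \<in> R" "(h, y) \<in> (away R t)\<^sup>*" using step.IH by blast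
    have "(y, z) \<in> away R t" using False step.hyps unfolding away_def by auto
    with h(3) have "(h, z) \<in> (away R t)\<^sup>*" by (rule rtrancl_into_rtrancl)
    then show ?thesis using h by blast
  qed
qed

lemma pcas_append: "pcas u p v \<Longrightarrow> pcas v q w \<Longrightarrow> pcas u (p @ q) w"
  by (induction p arbitrary: u) auto

text \<open>Two different neighbours of \<open>t\<close> joined in the tree without \<open>t\<close>
  would be joined by a path with distinct vertices, and closing it through \<open>t\<close> gives a
  cycle of length at least 3.\<close>

lemma no_detour_in_tree:
  assumes T: "undirected_tree T" and th: "(t, h) \<in> parcs T" "(t, h') \<in> parcs T" "h \<noteq> h'"
  shows "(h, h') \<notin> (away (parcs T) t)\<^sup>*"
proof
  assume r: "(h, h') \<in> (away (parcs T) t)\<^sup>*"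
  interpret pair_bidirected_digraph T by (rule undirected_tree_bidirected[OF T])
  let ?V = "pverts T - {t}"
  let ?G = "with_proj T \<restriction> ?V"
  interpret G': wf_digraph ?G by (rule wellformed_induce_subgraph)
  have ht: "h \<in> ?V" "h' \<in> ?V" "t \<in> pverts T"
    using in_arcsD2[OF th(1)] in_arcsD2[OF th(2)] in_arcsD1[OF th(1)] no_loops'[OF th(1)] no_loops'[OF th(2)]
    by simp_all
  have "(h, h') \<in> rtrancl_on ?V (away (parcs T) t)"
    by (rule rtrancl_consistent_rtrancl_on[OF r ht(1,2)]) (auto simp: away_def dest: in_arcsD2)
  then have "(h, h') \<in> rtrancl_on ?V (parcs T \<inter> ?V \<times> ?V)"
    by (rule rtrancl_on_mono[rotated 2]) (auto simp: away_def dest: in_arcsD1 in_arcsD2)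
  then have "h \<rightarrow>\<^sup>*\<^bsub>?G\<^esub> h'" unfolding reachable_def arcs_ends_induce by simp
  then obtain p where p: "G'.apath h p h'" unfolding G'.reachable_apath by blast
  have arcs: "set p \<subseteq> arcs ?G" and cas: "G'.cas h p h'" and dist: "distinct (G'.awalk_verts h p)"
    using p unfolding G'.apath_def G'.awalk_def by auto
  have "p \<noteq> []" using cas th(3) by auto
  have hv: "G'.awalk_verts h p = h # map snd p"
    using G'.awalk_verts_conv'[OF cas] cas \<open>p \<noteq> []\<close> by (cases p) auto
  have pcas: "pcas h p h'"
    using G'.awalk_def cas compatible_cas[OF compatible_induce_subgraph[of "with_proj T" ?V]]
    by (simp add: cas_with_proj_eq)
  let ?q = "(t, h) # p @ [(h', t)]"
  have "pcas h (p @ [(h', t)]) t" by (rule pcas_append[OF pcas]) simp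
  then have c: "pcas t ?q t" by (simp only: append.simps pcas.simps fst_conv snd_conv simp_thms)
  have sub: "set ?q \<subseteq> parcs T" using arcs th(1) arcs_symmetric[OF th(2)] by auto
  have pc: "pre_digraph.cas (with_proj T) t ?q t" using c by (simp add: cas_with_proj_eq)
  have "tl (pre_digraph.awalk_verts (with_proj T) t ?q) = h # map snd p @ [t]"
    using pre_digraph.awalk_verts_conv'[OF pc] by simp
  moreover have "t \<notin> snd ` set p" using arcs by auto
  ultimately have "distinct (tl (pre_digraph.awalk_verts (with_proj T) t ?q))"
    using dist ht(1) unfolding hv by auto
  then have "pre_digraph.cycle (with_proj T) ?q"
    unfolding pre_digraph.cycle_def pre_digraph.awalk_def using pc sub ht(3)
    by (intro exI[of _ t]) simp
  moreover have "3 \<le> length ?q" using \<open>p \<noteq> []\<close> by (cases p) auto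
  ultimately show False using T unfolding undirected_tree_def by blast
qed

text \<open>If \<open>A\<close> had no exit, each connected set \<open>S v\<close> would lie inside
  or outside \<open>A\<close>. This splits \<open>D\<close>, so some edge of \<open>\<Gamma>\<close>
  crosses the split, but its ends share a bag.\<close>

lemma conn_bags_meeting:
  assumes dec: "tree_decomposition \<Gamma> T B" and D: "conn (parcs \<Gamma>) D" "D \<subseteq> pverts \<Gamma>"
  shows "conn (parcs T) {g \<in> pverts T. B g \<inter> D \<noteq> {}}" (is "conn _ ?N")
proof -
  have T: "undirected_tree T" using dec by (simp add: tree_decomposition_def)
  define S N where "S v = {g \<in> pverts T. v \<in> B g}" and "N = ?N" for v
  have c: "conn (parcs T) (S v)" if "v \<in> D" for v
    using dec that D(2) unfolding tree_decomposition_def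
    by (auto simp: S_def connected_induce_iff[OF undirected_tree_sym[OF T]])
  have edge: "\<exists>g. g \<in> S v \<and> g \<in> S w" if "(v, w) \<in> parcs \<Gamma>" for v w
    using dec that unfolding tree_decomposition_def S_def by fastforce
  have sub: "S v \<subseteq> N" if "v \<in> D" for v using that unfolding S_def N_def by blast
  show ?thesis
    unfolding N_def[symmetric]
  proof (rule connI_exit)
    obtain v where "v \<in> D" using conn_nonempty[OF D(1)] by blast
    then show "N \<noteq> {}" using sub conn_nonempty[OF c] by blast
  next
    fix A x y assume xy: "x \<in> N" "x \<in> A" "y \<in> N" "y \<notin> A"
    show "\<exists>u v. u \<in> N \<and> u \<in> A \<and> v \<in> N \<and> v \<notin> A \<and> (u, v) \<in> parcs T"
    proof (rule ccontr)
      assume none: "\<not> ?thesis"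
      have all: "S v \<subseteq> A" if v: "v \<in> D" and g: "g \<in> S v" "g \<in> A" for v g
      proof
        fix k assume k: "k \<in> S v"
        show "k \<in> A"
        proof (rule ccontr)
          assume "k \<notin> A"
          with g(2) obtain a b where "a \<in> S v" "a \<in> A" "b \<in> S v" "b \<notin> A" "(a, b) \<in> parcs T"
            by (rule conn_exitE[OF c[OF v] g(1) _ k])
          moreover have "a \<in> N" "b \<in> N" using \<open>a \<in> S v\<close> \<open>b \<in> S v\<close> sub[OF v] by auto
          ultimately show False using none by blast
        qed
      qed
      let ?P = "{v. S v \<subseteq> A}"
      obtain u where u: "u \<in> D" "x \<in> S u" using xy(1) unfolding N_def S_def by blast
      obtain w where w: "w \<in> D" "y \<in> S w" using xy(3) unfolding N_def S_def by blast
      have "u \<in> ?P" using all[OF u xy(2)] by simp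
      moreover have "w \<notin> ?P" using w xy(4) by blast
      ultimately obtain a b where ab: "a \<in> D" "a \<in> ?P" "b \<in> D" "b \<notin> ?P" "(a, b) \<in> parcs \<Gamma>"
        by (rule conn_exitE[OF D(1) u(1) _ w(1)])
      obtain g where g: "g \<in> S a" "g \<in> S b" using edge[OF ab(5)] by blast
      have "g \<in> A" using g(1) ab(2) by blast
      then show False using all[OF ab(3) g(2)] ab(4) by blast
    qed
  qed
qed

text \<open>\<open>d\<close> is the distance from \<open>r\<close>; the last step of a shortest walk
  comes from a nearer node.\<close>

lemma tree_depth:
  assumes T: "undirected_tree T" and r: "r \<in> pverts T"
  shows "\<exists>d :: _ \<Rightarrow> nat. \<forall>g\<in>pverts T. g \<noteq> r \<longrightarrow> (\<exists>h. (h, g) \<in> parcs T \<and> d h < d g)"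
proof -
  define d where "d g = (LEAST k. (r, g) \<in> parcs T ^^ k)" for g
  have "\<exists>h. (h, g) \<in> parcs T \<and> d h < d g" if g: "g \<in> pverts T" "g \<noteq> r" for g
  proof -
    have "(r, g) \<in> (parcs T)\<^sup>*"
      using undirected_tree_conn[OF T] r g(1) rtrancl_on_rtranclI unfolding conn_iff_rtrancl_on by metis
    then have "\<exists>k. (r, g) \<in> parcs T ^^ k" by (rule rtrancl_imp_relpow[elim_format]) blast
    then have rel: "(r, g) \<in> parcs T ^^ d g" unfolding d_def by (rule LeastI_ex)
    then obtain k where k: "d g = Suc k" using g(2) by (cases "d g") auto
    then obtain h where h: "(r, h) \<in> parcs T ^^ k" "(h, g) \<in> parcs T" using rel by auto
    have "d h \<le> k" unfolding d_def using h(1) by (rule Least_le)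
    then show ?thesis using h(2) k by auto
  qed
  then show ?thesis by blast
qed

text \<open>
  Root the tree. Among the connected sets containing more than half of the vertices, take one whose
  subtree of bags starts deepest. The top bag of this subtree meets every such set.
\<close>

lemma bag_balanced_cutset:
  assumes \<Gamma>: "pair_graph \<Gamma>" and dec: "tree_decomposition \<Gamma> T B"
  obtains t where "t \<in> pverts T" "balanced_cutset \<Gamma> (B t)"
proof -
  interpret pair_graph \<Gamma> by fact
  have T: "undirected_tree T" and cover: "(\<Union>g\<in>pverts T. B g) = pverts \<Gamma>"
    and bags: "\<And>g. g \<in> pverts T \<Longrightarrow> B g \<subseteq> pverts \<Gamma>"
    using dec by (simp_all add: tree_decomposition_def)
  define big where "big D \<longleftrightarrow> conn (parcs \<Gamma>) D \<and> D \<subseteq> pverts \<Gamma> \<and> card (pverts \<Gamma>) < 2 * card D" for D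
  have balanced: "balanced_cutset \<Gamma> (B t)" if t: "t \<in> pverts T" "\<And>D. big D \<Longrightarrow> B t \<inter> D \<noteq> {}" for t
    unfolding balanced_cutset_iff[OF \<Gamma>]
  proof (intro conjI allI impI)
    fix D assume D: "conn (parcs \<Gamma>) D" "D \<subseteq> pverts \<Gamma> - B t"
    then have "\<not> big D" using t(2)[of D] by blast
    then show "2 * card D \<le> card (pverts \<Gamma>)" using D unfolding big_def by auto
  qed (use bags t(1) in blast)
  obtain r where r: "r \<in> pverts T" using conn_nonempty[OF undirected_tree_conn[OF T]] by blast
  show thesis
  proof (cases "\<exists>D. big D")
    case False
    then show thesis using that[OF r] balanced[OF r] by blast
  next
    case True
    obtain d :: "_ \<Rightarrow> nat"
      where d: "\<forall>g\<in>pverts T. g \<noteq> r \<longrightarrow> (\<exists>h. (h, g) \<in> parcs T \<and> d h < d g)"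
      using tree_depth[OF T r] ..
    define N where "N D = {g \<in> pverts T. B g \<inter> D \<noteq> {}}" for D
    have N_conn: "conn (parcs T) (N D)" if "big D" for D
      using conn_bags_meeting[OF dec] that unfolding big_def N_def by blast
    define top where "top D = (LEAST k. \<exists>g\<in>N D. d g = k)" for D
    have top_ex: "\<exists>g\<in>N D. d g = top D" if D: "big D" for D
    proof -
      obtain g where "g \<in> N D" using conn_nonempty[OF N_conn[OF D]] by blast
      then have "\<exists>k. \<exists>g\<in>N D. d g = k" by blast
      then show ?thesis unfolding top_def by (rule LeastI_ex)
    qed
    have top_le: "top D \<le> d g" if "g \<in> N D" for D g
      unfolding top_def by (rule Least_le) (use that in blast)
    have "finite {D. big D}"
      by (rule finite_subset[of _ "Pow (pverts \<Gamma>)"]) (auto simp: big_def pair_finite_verts)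
    then have "finite (top ` {D. big D})" by (rule finite_imageI)
    moreover have "top ` {D. big D} \<noteq> {}" using True by blast
    ultimately have "Max (top ` {D. big D}) \<in> top ` {D. big D}"
      "\<forall>k\<in>top ` {D. big D}. k \<le> Max (top ` {D. big D})" by (rule Max_in, simp)
    then obtain D0 where D0: "big D0" "\<And>D. big D \<Longrightarrow> top D \<le> top D0" by auto
    obtain t where t: "t \<in> N D0" "d t = top D0" using top_ex[OF D0(1)] by blast
    have tT: "t \<in> pverts T" using t(1) unfolding N_def by blast
    \<comment> \<open>If the bag at \<open>t\<close> misses \<open>D\<close>, then the subtree
      \<open>N D\<close> avoids \<open>t\<close>. Since \<open>D\<close> and \<open>D0\<close>
      intersect, there is a walk in the tree without \<open>t\<close>: from a neighbour
      \<open>h'\<close> of \<open>t\<close> in \<open>N D0\<close> to a common node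
      \<open>x\<close>, on to the top \<open>y\<close> of \<open>N D\<close>, to the root, and back
      to the parent \<open>h\<close> of \<open>t\<close>.\<close>
    have "B t \<inter> D \<noteq> {}" if D: "big D" for D
    proof
      assume "B t \<inter> D = {}"
      then have tD: "t \<notin> N D" unfolding N_def by blast
      have fin: "finite D" "finite D0"
        using D D0(1) pair_finite_verts unfolding big_def by (auto intro: finite_subset)
      have "D \<inter> D0 \<noteq> {}"
      proof
        assume "D \<inter> D0 = {}"
        then have "card D + card D0 = card (D \<union> D0)" using card_Un_disjoint[OF fin] by simp
        also have "\<dots> \<le> card (pverts \<Gamma>)"
          using D D0(1) unfolding big_def by (intro card_mono[OF pair_finite_verts]) blast
        finally show False using D D0(1) unfolding big_def by linarith
      qed
      then obtain v where v: "v \<in> D" "v \<in> D0" by blast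
      then have "v \<in> pverts \<Gamma>" using D unfolding big_def by blast
      then obtain x where x: "x \<in> pverts T" "v \<in> B x" using cover by blast
      have xN: "x \<in> N D" "x \<in> N D0" using x v unfolding N_def by blast+
      obtain y where y: "y \<in> N D" "d y = top D" using top_ex[OF D] by blast
      have dy: "d y \<le> d t" using y(2) t(2) D0(2)[OF D] by simp
      let ?A = "away (parcs T) t"
      \<comment> \<open>Descending from a node no deeper than \<open>t\<close> and different from
        it, every later node is strictly less deep than \<open>t\<close>, so \<open>t\<close> is
        never met.\<close>
      have to_root: "(g, r) \<in> ?A\<^sup>*" if "g \<in> pverts T" "g \<noteq> t" "d g \<le> d t" for g
        using that
      proof (induction "d g" arbitrary: g rule: less_induct)
        case less
        show ?case
        proof (cases "g = r")
          case False
          then obtain h where h: "(h, g) \<in> parcs T" "d h < d g" using d less.prems(1) by blast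
          have hg: "(g, h) \<in> parcs T" by (rule symD[OF undirected_tree_sym[OF T] h(1)])
          have "h \<in> pverts T" "h \<noteq> t"
            using pair_wf_digraph.in_arcsD1[OF _ h(1)] undirected_tree_bidirected[OF T] h(2) less.prems(3)
            by (auto simp: pair_bidirected_digraph_def pair_sym_digraph_def)
          then have "(h, r) \<in> ?A\<^sup>*" using less.hyps[OF h(2)] h(2) less.prems(3) by simp
          moreover have "(g, h) \<in> ?A" using hg \<open>h \<noteq> t\<close> less.prems(2) unfolding away_def by simp
          ultimately show ?thesis by (rule converse_rtrancl_into_rtrancl[rotated])
        qed simp
      qed
      have yT: "y \<in> pverts T" "y \<noteq> t" using y(1) tD unfolding N_def by auto
      have "t \<noteq> r"
      proof
        assume "t = r"
        have "(y, t) \<in> ?A\<^sup>*" using to_root[OF yT dy] \<open>t = r\<close> by simp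
        then show False using yT(2) by (cases rule: rtrancl.cases) (auto simp: away_def)
      qed
      then obtain h where h: "(h, t) \<in> parcs T" "d h < d t" using d tT by blast
      have th: "(t, h) \<in> parcs T" by (rule symD[OF undirected_tree_sym[OF T] h(1)])
      have "h \<in> pverts T" "h \<noteq> t"
        using pair_wf_digraph.in_arcsD1[OF _ h(1)] undirected_tree_bidirected[OF T] h(2)
        by (auto simp: pair_bidirected_digraph_def pair_sym_digraph_def)
      then have hr: "(h, r) \<in> ?A\<^sup>*" using to_root h(2) by simp
      have yr: "(y, r) \<in> ?A\<^sup>*" by (rule to_root[OF yT dy])
      have "(x, y) \<in> rtrancl_on (N D) (parcs T)"
        using N_conn[OF D] xN(1) y(1) unfolding conn_iff_rtrancl_on by blast
      then have xy: "(x, y) \<in> ?A\<^sup>*" using tD by (rule rtrancl_on_away)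
      have "(t, x) \<in> rtrancl_on (N D0) (parcs T)"
        using N_conn[OF D0(1)] t(1) xN(2) unfolding conn_iff_rtrancl_on by blast
      moreover have "x \<noteq> t" using xN(1) tD by blast
      ultimately obtain h' where h': "h' \<in> N D0" "(t, h') \<in> parcs T" "(h', x) \<in> ?A\<^sup>*"
        using last_departure by metis
      \<comment> \<open>No node of \<open>N D0\<close> is less deep than its top \<open>t\<close>,
        whereas the parent \<open>h\<close> is.\<close>
      have "d t \<le> d h'" using top_le[OF h'(1)] t(2) by simp
      then have "h' \<noteq> h" using h(2) by auto
      have "sym (?A\<^sup>*)" by (rule sym_rtrancl[OF sym_away[OF undirected_tree_sym[OF T]]])
      then have "(r, h) \<in> ?A\<^sup>*" using hr by (rule symD)
      then have "(h', h) \<in> ?A\<^sup>*" using h'(3) xy yr by (meson rtrancl_trans)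
      then show False using no_detour_in_tree[OF T h'(2) th \<open>h' \<noteq> h\<close>] by blast
    qed
    then show thesis using that[OF tT] balanced[OF tT] by blast
  qed
qed

lemma cutsize_le_treewidth:
  assumes "pair_graph \<Gamma>"
  shows "int (cutsize \<Gamma>) \<le> treewidth \<Gamma> + 1"
proof -
  obtain T :: "nat pair_pre_digraph" and B
    where T: "tree_decomposition \<Gamma> T B" "decomposition_width T B = treewidth \<Gamma>"
    using treewidth_attained[OF assms] by metis
  obtain t where t: "t \<in> pverts T" "balanced_cutset \<Gamma> (B t)" by (rule bag_balanced_cutset[OF assms T(1)])
  show ?thesis using cutsize_le[OF assms t(2)] card_bag_le_width[OF assms T(1) t(1)] T(2) by linarith
qed

section \<open>Induced subgraphs and the upper bound\<close>

definition induced :: "'a pair_pre_digraph \<Rightarrow> 'a set \<Rightarrow> 'a pair_pre_digraph" where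
  "induced \<Gamma> H = \<lparr>pverts = H, parcs = parcs \<Gamma> \<inter> H \<times> H\<rparr>"

lemma induced_simps[simp]:
  "pverts (induced \<Gamma> H) = H" "parcs (induced \<Gamma> H) = parcs \<Gamma> \<inter> H \<times> H"
  by (simp_all add: induced_def)

lemma pair_graph_induced:
  assumes "pair_graph \<Gamma>" "H \<subseteq> pverts \<Gamma>"
  shows "pair_graph (induced \<Gamma> H)"
proof -
  interpret pair_graph \<Gamma> by fact
  show ?thesis
  proof
    show "symmetric (with_proj (induced \<Gamma> H))"
      using arcs_symmetric by (auto simp: symmetric_def intro!: symI)
    show "finite (pverts (induced \<Gamma> H))"
      using finite_subset[OF assms(2) pair_finite_verts] by simp
    show "finite (parcs (induced \<Gamma> H))" using pair_finite_arcs by simp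
    show "fst e \<noteq> snd e" if "e \<in> parcs (induced \<Gamma> H)" for e
      using that pair_no_loops[of e] by simp
  qed auto
qed

lemma treewidth_le_cutsize:
  assumes \<Gamma>: "pair_graph \<Gamma>" and s: "\<And>H. H \<subseteq> pverts \<Gamma> \<Longrightarrow> cutsize (induced \<Gamma> H) \<le> s"
  shows "treewidth \<Gamma> \<le> 15 * int s"
proof (cases "pverts \<Gamma> = {}")
  case True
  then show ?thesis using treewidth_bounds(2)[OF \<Gamma>] by simp
next
  case False
  interpret pair_graph \<Gamma> by fact
  have cut: "\<exists>S\<subseteq>H. card S \<le> s \<and> (\<forall>D. conn (parcs \<Gamma>) D \<longrightarrow> D \<subseteq> H - S \<longrightarrow> 2 * card D \<le> card H)"
    if H: "H \<subseteq> pverts \<Gamma>" for H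
  proof -
    have g: "pair_graph (induced \<Gamma> H)" by (rule pair_graph_induced[OF \<Gamma> H])
    obtain S where S: "balanced_cutset (induced \<Gamma> H) S" "card S = cutsize (induced \<Gamma> H)"
      by (rule cutsize_attained[OF g])
    have "2 * card D \<le> card H" if "conn (parcs \<Gamma>) D" "D \<subseteq> H - S" for D
    proof -
      have "conn (parcs \<Gamma> \<inter> H \<times> H) D" using that conn_restrict[of D H] by blast
      then show ?thesis using S(1) that(2) unfolding balanced_cutset_iff[OF g] by simp
    qed
    moreover have "S \<subseteq> H" using S(1) unfolding balanced_cutset_iff[OF g] by simp
    ultimately show ?thesis using S(2) s[OF H] by auto
  qed
  obtain v where v: "v \<in> pverts \<Gamma>" using False by blast
  \<comment> \<open>A graph with one vertex has cutsize 1, as that vertex is more than half of it;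
    this forces \<open>s\<close> to be positive.\<close>
  obtain S where S: "S \<subseteq> {v}" "card S \<le> s"
    "\<And>D. conn (parcs \<Gamma>) D \<Longrightarrow> D \<subseteq> {v} - S \<Longrightarrow> 2 * card D \<le> card {v}"
    using cut[of "{v}"] v by auto
  have "S \<noteq> {}" using S(3)[OF conn_singleton[of _ v]] by auto
  then have s_pos: "1 \<le> s" using S(1,2) by (auto simp: subset_singleton_iff)
  interpret halving "parcs \<Gamma>" "pverts \<Gamma>" s
    by unfold_locales (use pair_finite_verts sym_parcs s_pos cut in auto)
  obtain Y \<T> where td: "tdec (parcs \<Gamma>) Y \<T>" "\<Union>\<T> = pverts \<Gamma>" "\<And>Z. Z \<in> \<T> \<Longrightarrow> card Z \<le> 14 * s"
  proof (rule tdec_if_no_bramble[OF pair_finite_verts sym_parcs])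
    show "parcs \<Gamma> \<subseteq> pverts \<Gamma> \<times> pverts \<Gamma>" using in_arcsD1 in_arcsD2 by auto
  qed (use bramble_order_le in auto)
  obtain T :: "nat pair_pre_digraph" and B where T: "tree_decomposition \<Gamma> T B" "B ` pverts T = \<T>"
    by (rule tree_decomposition_if_tdec[OF td(1,2) \<Gamma>])
  have "decomposition_width T B \<le> 15 * int s"
  proof (rule width_le[OF \<Gamma> T(1)])
    fix g assume "g \<in> pverts T"
    then have "card (B g) \<le> 14 * s" using T(2) td(3) by blast
    then show "int (card (B g)) \<le> 15 * int s + 1" by linarith
  qed
  then show ?thesis using treewidth_le_width[OF \<Gamma> T(1)] by simp
qed

text \<open>Through this closure the single value \<open>separation_profile X r\<close> bounds the
  cutsizes of all induced subgraphs of \<open>\<Gamma>\<close>.\<close>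

lemma finite_subgraphs_induced:
  assumes "\<Gamma> \<in> finite_subgraphs X r" "H \<subseteq> pverts \<Gamma>"
  shows "induced \<Gamma> H \<in> finite_subgraphs X r"
proof -
  have \<Gamma>: "pair_graph \<Gamma>" "subgraph (with_proj \<Gamma>) (with_proj X)" "card (pverts \<Gamma>) \<le> r"
    using assms(1) unfolding finite_subgraphs_def by auto
  interpret pair_graph \<Gamma> by (rule \<Gamma>(1))
  interpret I: pair_graph "induced \<Gamma> H" by (rule pair_graph_induced[OF \<Gamma>(1) assms(2)])
  have "subgraph (with_proj (induced \<Gamma> H)) (with_proj \<Gamma>)"
  proof (rule subgraphI)
    show "wf_digraph (with_proj (induced \<Gamma> H))" "wf_digraph (with_proj \<Gamma>)" by unfold_locales
  qed (use assms(2) in auto)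
  then have "subgraph (with_proj (induced \<Gamma> H)) (with_proj X)" using \<Gamma>(2) by (rule subgraph_trans)
  moreover have "card H \<le> r" using card_mono[OF pair_finite_verts assms(2)] \<Gamma>(3) by simp
  ultimately show ?thesis unfolding finite_subgraphs_def using I.pair_graph by simp
qed

theorem proposition1p5:
  fixes X :: "'a pair_pre_digraph" and r :: nat
  assumes "pair_bidirected_digraph X"
  shows "int (separation_profile X r) - 1 \<le> Max (treewidth ` finite_subgraphs X r)
       \<and> Max (treewidth ` finite_subgraphs X r) \<le> 15 * int (separation_profile X r)"
proof -
  interpret X: pair_bidirected_digraph X by fact
  let ?\<G> = "finite_subgraphs X r"
  have \<G>: "pair_graph \<Gamma>" "card (pverts \<Gamma>) \<le> r" if "\<Gamma> \<in> ?\<G>" for \<Gamma>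
    using that unfolding finite_subgraphs_def by auto
  \<comment> \<open>The empty graph is always available, so neither \<open>Max\<close> ranges over
    an empty set.\<close>
  have nonempty: "?\<G> \<noteq> {}"
  proof -
    let ?E = "\<lparr>pverts = {}, parcs = {}\<rparr> :: 'a pair_pre_digraph"
    have g: "pair_graph ?E" by unfold_locales (auto simp: symmetric_def sym_def)
    interpret E: pair_graph ?E by (rule g)
    have "subgraph (with_proj ?E) (with_proj X)"
    proof (rule subgraphI)
      show "wf_digraph (with_proj ?E)" "wf_digraph (with_proj X)" by unfold_locales
    qed auto
    then have "?E \<in> ?\<G>" using g unfolding finite_subgraphs_def by simp
    then show ?thesis by blast
  qed
  \<comment> \<open>There may be infinitely many subgraphs, but their cutsizes and treewidths take
    finitely many values, so both maxima exist.\<close>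
  have "cutsize \<Gamma> \<le> r" if "\<Gamma> \<in> ?\<G>" for \<Gamma>
    using cutsize_le_card[OF \<G>(1)[OF that]] \<G>(2)[OF that] by simp
  then have "cutsize ` ?\<G> \<subseteq> {..r}" by auto
  then have fin_cut: "finite (cutsize ` ?\<G>)" by (rule finite_subset) simp
  have "- 1 \<le> treewidth \<Gamma> \<and> treewidth \<Gamma> \<le> int r" if "\<Gamma> \<in> ?\<G>" for \<Gamma>
    using treewidth_bounds[OF \<G>(1)[OF that]] \<G>(2)[OF that] by linarith
  then have "treewidth ` ?\<G> \<subseteq> {- 1..int r}" by auto
  then have fin_tw: "finite (treewidth ` ?\<G>)" by (rule finite_subset) simp
  have cut_le: "cutsize \<Gamma> \<le> separation_profile X r" if "\<Gamma> \<in> ?\<G>" for \<Gamma>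
    unfolding separation_profile_def using fin_cut that by simp
  have "separation_profile X r \<in> cutsize ` ?\<G>"
    unfolding separation_profile_def using fin_cut nonempty by (intro Max_in) auto
  then obtain \<Gamma> where \<Gamma>: "\<Gamma> \<in> ?\<G>" "separation_profile X r = cutsize \<Gamma>" by blast
  have "int (separation_profile X r) - 1 \<le> treewidth \<Gamma>"
    using cutsize_le_treewidth[OF \<G>(1)[OF \<Gamma>(1)]] \<Gamma>(2) by simp
  also have "\<dots> \<le> Max (treewidth ` ?\<G>)" using fin_tw \<Gamma>(1) by simp
  finally have lower: "int (separation_profile X r) - 1 \<le> Max (treewidth ` ?\<G>)" .
  have "treewidth \<Gamma> \<le> 15 * int (separation_profile X r)" if "\<Gamma> \<in> ?\<G>" for \<Gamma>
    using treewidth_le_cutsize[OF \<G>(1)[OF that]] cut_le finite_subgraphs_induced[OF that] by blast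
  then have "Max (treewidth ` ?\<G>) \<le> 15 * int (separation_profile X r)"
    using fin_tw nonempty by (intro Max.boundedI) auto
  with lower show ?thesis by simp
qed

end
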